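(* Let $\beta>1$ be the tribonacci number, i.e. the real root $\beta=1.8392867552\dots$ of $\beta^3=\beta^2+\beta+1$. Then for Lebesgue-a.e. $\alpha\in[0,1]$ the generalised $\beta$-transformation $G_{\alpha,\beta}$ has matching, i.e. there is an integer $\kappa\ge 1$ such that $G_{\alpha,\beta}^{\kappa}(0)=G_{\alpha,\beta}^{\kappa}(1)$.
   Context: For $\alpha\in[0,1]$ and $\beta>1$, the generalised $\beta$-transformation is $G_{\alpha,\beta}:[0,1]\to[0,1]$, $G_{\alpha,\beta}(x)=\beta x+\alpha\pmod 1$. *)

theory Defs
  imports "HOL-Analysis.Analysis"
begin

text \<open>
  Reduction mod 1 is \<^const>\<open>frac\<close>, with values in the half-open interval \<open>{0..<1}\<close>.
  The map is total on the reals, but only its restriction to \<open>{0..1}\<close> is meaningful.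
\<close>

definition gen_beta_map :: "real \<Rightarrow> real \<Rightarrow> real \<Rightarrow> real" where
  "gen_beta_map \<alpha> \<beta> x = frac (\<beta> * x + \<alpha>)"

definition has_matching :: "real \<Rightarrow> real \<Rightarrow> bool" where
  "has_matching \<alpha> \<beta> \<longleftrightarrow>
     (\<exists>\<kappa>::nat. \<kappa> \<ge> 1 \<and> (gen_beta_map \<alpha> \<beta> ^^ \<kappa>) 0 = (gen_beta_map \<alpha> \<beta> ^^ \<kappa>) 1)"

end

theory Submission
  imports Defs
begin

text \<open>
  Put \<open>\<gamma> = 1 / \<beta>\<close>, so that \<open>\<gamma> + \<gamma>\<^sup>2 + \<gamma>\<^sup>3 = 1\<close>.  From time 1 on, the distance of the orbits of 0 and 1
  is one of the numbers \<open>0\<close>, \<open>\<gamma>\<close> and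
  \<open>A = 1 - \<gamma>\<^sup>3\<close>, \<open>B = 1 - \<gamma>\<close>, \<open>C = \<gamma>\<^sup>3\<close>, \<open>D = \<gamma>\<^sup>2\<close>, \<open>E = 1 - \<gamma>\<^sup>2\<close>; call the last five the gaps.
  Two points at distance \<open>\<gamma>\<close> have the same image, so matching fails exactly if the
  distance is a gap forever.  One step of the map allows \<open>A, D \<rightarrow> \<gamma> or B\<close>, \<open>B \<rightarrow> A or C\<close> and
  \<open>C, E \<rightarrow> D or E\<close>, the choice depending on the position of the lower of the two points.

  Fix \<open>\<alpha>\<close>, and consider all pairs of points of \<open>{0..1}\<close> at distance a gap \<open>h\<close>, not only those on
  the two orbits.  Such pairs are parametrised by the lower point, in \<open>{0..1 - h}\<close>.
  Suppose that an interval of lower points contains no pair that ever matches.  Its images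
  are again such intervals, cut where the gap changes.  The images of intervals in \<open>A\<close> or \<open>D\<close>
  are never cut, because pairs on the other side of the cut match, and
  the expansion by \<open>\<beta>\<close> beats the cuts in the other gaps unless an image
  contains all pairs with gap \<open>A\<close> or all pairs with gap \<open>E\<close> (\<open>whole_A_or_E\<close>).
  Either case is impossible when \<open>\<alpha> < \<gamma>\<close> (\<open>not_whole_A\<close>, \<open>not_whole_E\<close>), and
  by the symmetry \<open>x \<mapsto> 1 - x\<close> when \<open>\<alpha> > 1 - \<gamma> + \<gamma>\<^sup>3\<close>.  In between there do exist intervals of
  pairs that never match, but there the orbits of 0 and 1 themselves match after four steps
  (\<open>matching_middle\<close>).  Hence, outside two exceptional parameters and the middle interval,
  pairs that match are dense (\<open>not_surviving\<close>).

  It remains to pass from points to parameters.  As long as \<open>\<alpha>\<close> meets no discontinuity, the \<open>n\<close>-th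
  iterates of 0 and 1 are affine in \<open>\<alpha>\<close> with slope \<open>s\<^sub>n = (\<beta>\<^sup>n - 1) / (\<beta> - 1)\<close>, and their difference is
  constant.  Discontinuities of the \<open>k\<close>-th iterates are of the form \<open>v / s\<^sub>k\<close>, where \<open>v\<close> lies in a
  set \<open>\<Lambda>\<close> of elements of \<open>\<int>[\<beta>]\<close> whose conjugates are bounded.  As the norm of a nonzero element is a
  nonzero integer, \<open>\<Lambda>\<close> is uniformly discrete (\<open>Lambda_separated\<close>); this is where it matters that
  \<open>\<beta>\<close> is a Pisot number.  So up to time \<open>n\<close> there are only \<open>O(s\<^sub>n)\<close> discontinuities, and
  for almost every \<open>\<alpha>\<^sub>0\<close> there is \<open>\<eta> > 0\<close> such that, for infinitely many \<open>n\<close>, none is within \<open>\<eta> / s\<^sub>n\<close> of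
  \<open>\<alpha>\<^sub>0\<close> (\<open>almost_all_uncrowded\<close>).  If \<open>\<alpha>\<^sub>0\<close> has no matching, then for such \<open>n\<close> the \<open>n\<close>-th iterates sweep
  an interval of pairs of length \<open>2 * \<eta>\<close> while \<open>\<alpha>\<close> runs through that neighbourhood.  A fixed
  proportion of these pairs match, by density and because matching is stable under small
  changes of \<open>\<alpha>\<close> (\<open>robust_points\<close>).  So the set of parameters without matching is porous up
  to a null set (\<open>nonmatching_porous\<close>), and porous sets are null (\<open>negligible_porous\<close>).
\<close>

section \<open>The algebra of the tribonacci number\<close>

locale tribonacci =
  fixes \<beta> \<gamma> :: real
  assumes beta_gt_1: "\<beta> > 1" and beta_cubic: "\<beta> ^ 3 = \<beta> ^ 2 + \<beta> + 1"
    and gamma_def: "\<gamma> = 1 / \<beta>"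
begin

lemma beta_gamma: "\<beta> * \<gamma> = 1"
  using beta_gt_1 by (simp add: gamma_def)

lemma gamma_cubic: "\<gamma> ^ 3 = 1 - \<gamma> - \<gamma> ^ 2"
proof -
  have "\<gamma>^3 * \<beta>^3 = \<gamma>^3 * (\<beta>^2 + \<beta> + 1)" by (simp add: beta_cubic)
  moreover have "\<gamma>^3 * \<beta>^3 = 1" "\<gamma>^3 * \<beta>^2 = \<gamma>" "\<gamma>^3 * \<beta> = \<gamma>^2"
    using beta_gt_1 by (simp_all add: gamma_def field_simps power2_eq_square power3_eq_cube)
  ultimately show ?thesis by (simp add: algebra_simps)
qed

lemma beta_eq: "\<beta> = 1 + \<gamma> + \<gamma> ^ 2"
proof -
  have "\<beta> * (\<gamma> + \<gamma>^2 + \<gamma>^3) = \<beta>" using gamma_cubic by simp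
  moreover have "\<beta> * (\<gamma> + \<gamma>^2 + \<gamma>^3) = (\<beta>*\<gamma>) * (1 + \<gamma> + \<gamma>^2)"
    by (simp add: algebra_simps power2_eq_square power3_eq_cube)
  ultimately show ?thesis using beta_gamma by simp
qed

lemma gamma_pos: "0 < \<gamma>"
  using beta_gt_1 by (simp add: gamma_def)

lemma gamma_lower: "543/1000 < \<gamma>"
proof (rule ccontr)
  assume "\<not> 543/1000 < \<gamma>"
  then have "\<gamma> \<le> 543/1000" by simp
  then have "\<gamma>^2 \<le> (543/1000)^2" "\<gamma>^3 \<le> (543/1000)^3"
    using gamma_pos by (intro power_mono; simp)+
  then show False using \<open>\<gamma> \<le> 543/1000\<close> gamma_cubic by (simp add: power2_eq_square power3_eq_cube)
qed

lemma gamma_upper: "\<gamma> < 544/1000"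
proof (rule ccontr)
  assume "\<not> \<gamma> < 544/1000"
  then have "544/1000 \<le> \<gamma>" by simp
  then have "(544/1000)^2 \<le> \<gamma>^2" "(544/1000)^3 \<le> \<gamma>^3"
    by (intro power_mono; simp)+
  then show False using \<open>544/1000 \<le> \<gamma>\<close> gamma_cubic by (simp add: power2_eq_square power3_eq_cube)
qed

lemma gamma_sq_bounds: "294/1000 < \<gamma>^2" "\<gamma>^2 < 296/1000"
proof -
  have "(543/1000)^2 < \<gamma>^2" "\<gamma>^2 < (544/1000)^2"
    using gamma_lower gamma_upper by (intro power_strict_mono; simp)+
  then show "294/1000 < \<gamma>^2" "\<gamma>^2 < 296/1000" by (simp_all add: power2_eq_square)
qed

lemmas gamma_bounds = gamma_lower gamma_upper gamma_sq_bounds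

lemma beta_times_gamma_sq: "\<beta> * \<gamma>^2 = \<gamma>"
  using beta_gamma by (simp add: power2_eq_square mult.assoc[symmetric])

lemma beta_gamma_cube: "\<beta> * \<gamma>^3 = \<gamma>^2"
  using beta_gamma by (simp add: power2_eq_square power3_eq_cube mult.assoc[symmetric])

lemma beta_sq: "\<beta>^2 = \<beta> + 1 + \<gamma>"
proof -
  have "\<beta> * \<beta> = \<beta> * (1 + \<gamma> + \<gamma>^2)" using beta_eq by (rule arg_cong)
  then show ?thesis
    using beta_gamma beta_times_gamma_sq by (simp add: power2_eq_square distrib_left)
qed

lemma beta_bounds: "183/100 < \<beta>" "\<beta> < 184/100"
  using gamma_bounds beta_eq by linarith+

lemma gamma_cube_bounds: "160/1000 < \<gamma>^3" "\<gamma>^3 < 163/1000"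
  using gamma_bounds gamma_cubic by linarith+

text \<open>
  These five relations say which distances \<open>\<beta> * h\<close> can become modulo 1; they are the
  transitions \<open>A \<rightarrow> \<gamma>\<close>, \<open>B \<rightarrow> A\<close>, \<open>C \<rightarrow> D\<close>, \<open>E \<rightarrow> D\<close>, \<open>D \<rightarrow> \<gamma>\<close>.  If \<open>\<beta> * h - h'\<close> is an integer then so is
  \<open>\<beta> * h + (1 - h')\<close>, which gives the second alternative of each transition, with the two
  points in reversed order.
\<close>

lemma gap_ints:
  "\<beta> * (1 - \<gamma>^3) - \<gamma> \<in> \<int>" "\<beta> * (1 - \<gamma>) - (1 - \<gamma>^3) \<in> \<int>" "\<beta> * \<gamma>^3 - \<gamma>^2 \<in> \<int>"
  "\<beta> * (1 - \<gamma>^2) - \<gamma>^2 \<in> \<int>" "\<beta> * \<gamma>^2 - \<gamma> \<in> \<int>"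
proof -
  have "\<beta> * (1 - \<gamma>^3) - \<gamma> = 1" "\<beta> * (1 - \<gamma>) - (1 - \<gamma>^3) = 0"
    "\<beta> * \<gamma>^3 - \<gamma>^2 = 0" "\<beta> * (1 - \<gamma>^2) - \<gamma>^2 = 1" "\<beta> * \<gamma>^2 - \<gamma> = 0"
    using beta_gamma_cube beta_gamma beta_times_gamma_sq beta_eq gamma_cubic
    unfolding right_diff_distrib by linarith+
  then show "\<beta> * (1 - \<gamma>^3) - \<gamma> \<in> \<int>" "\<beta> * (1 - \<gamma>) - (1 - \<gamma>^3) \<in> \<int>" "\<beta> * \<gamma>^3 - \<gamma>^2 \<in> \<int>"
    "\<beta> * (1 - \<gamma>^2) - \<gamma>^2 \<in> \<int>" "\<beta> * \<gamma>^2 - \<gamma> \<in> \<int>"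
    by (simp_all only: Ints_0 Ints_1)
qed

definition gaps :: "real set" where
  "gaps = {1 - \<gamma>^3, 1 - \<gamma>, \<gamma>^3, \<gamma>^2, 1 - \<gamma>^2}"

end

section \<open>Interval dynamics of pairs at a fixed distance\<close>

text \<open>
  Read \<open>good h u v\<close> as: no pair \<open>(z, z + h)\<close> with \<open>z\<close> strictly between \<open>u\<close> and \<open>v\<close> ever matches,
  in the strong sense of \<open>robustly_match\<close> below.
  The two transport rules describe the image of such an interval under one step, according
  to whether the images of the two points keep or exchange their order.  Only these rules are
  assumed, so that the results also apply to the reflection of the system
  under \<open>x \<mapsto> 1 - x\<close>, which replaces \<open>\<alpha>\<close> by \<open>1 + \<gamma>\<^sup>3 - \<alpha>\<close>.
\<close>

locale survivors = tribonacci +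
  fixes \<alpha> :: real and good :: "real \<Rightarrow> real \<Rightarrow> real \<Rightarrow> bool"
  assumes good_range: "good h u v \<Longrightarrow> 0 \<le> u \<and> u < v \<and> v \<le> 1 - h"
    and good_plus: "\<lbrakk>good h u v; \<beta> * h - h' \<in> \<int>; n \<in> \<int>; 0 < h';
      \<beta> * u + \<alpha> \<le> n + p; n + q \<le> \<beta> * v + \<alpha>; 0 \<le> p; p < q; q \<le> 1 - h'\<rbrakk> \<Longrightarrow> good h' p q"
    and good_minus: "\<lbrakk>good h u v; \<beta> * h + h' \<in> \<int>; n \<in> \<int>; 0 < h';
      \<beta> * u + \<alpha> \<le> n + h' + p; n + h' + q \<le> \<beta> * v + \<alpha>; 0 \<le> p; p < q; q \<le> 1 - h'\<rbrakk>
      \<Longrightarrow> good h' p q"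
    and not_good_gamma: "\<not> good \<gamma> u v"
    and alpha_range: "0 \<le> \<alpha>" "\<alpha> < \<gamma>"
begin

text \<open>
  From gaps \<open>A\<close> and \<open>D\<close> a pair goes to distance \<open>\<gamma>\<close>, and so matches, or to gap \<open>B\<close>.  The points where
  the alternative changes all border on a region of matching, so a surviving interval
  must be mapped into \<open>B\<close> uncut.
\<close>

lemma good_into_B:
  assumes "good h u v" "\<beta> * h - \<gamma> \<in> \<int>"
  obtains n where "n \<in> \<int>" "n - \<gamma> \<le> \<beta> * u + \<alpha>" "\<beta> * v + \<alpha> \<le> n"
    "good (1 - \<gamma>) (\<beta> * u + \<alpha> - n + \<gamma>) (\<beta> * v + \<alpha> - n + \<gamma>)"
proof -
  define n :: real where "n = of_int \<lceil>\<beta> * v + \<alpha>\<rceil>"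
  have n: "n \<in> \<int>" "\<beta> * v + \<alpha> \<le> n" "n - 1 < \<beta> * v + \<alpha>"
    unfolding n_def by (simp, linarith+)
  have uv: "\<beta> * u < \<beta> * v"
    using good_range[OF assms(1)] beta_gt_1 by simp
  have u: "n - \<gamma> \<le> \<beta> * u + \<alpha>"
  proof (rule ccontr)
    assume "\<not> n - \<gamma> \<le> \<beta> * u + \<alpha>"
    \<comment> \<open>The part of the image where the new distance is \<open>\<gamma>\<close>.\<close>
    define p where "p = max (\<beta> * u + \<alpha>) (n - 1)"
    define q where "q = min (\<beta> * v + \<alpha>) (n - \<gamma>)"
    have "p < q" unfolding p_def q_def
      using \<open>\<not> n - \<gamma> \<le> \<beta> * u + \<alpha>\<close> n uv gamma_bounds by auto
    have "good \<gamma> (p - (n - 1)) (q - (n - 1))"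
      by (rule good_plus[OF assms, of "n - 1"])
        (use \<open>p < q\<close> n gamma_pos in \<open>auto simp: p_def q_def\<close>)
    then show False using not_good_gamma by blast
  qed
  have "\<beta> * h + (1 - \<gamma>) = (\<beta> * h - \<gamma>) + 1" by simp
  then have i: "\<beta> * h + (1 - \<gamma>) \<in> \<int>" using assms(2) by (metis Ints_1 Ints_add)
  have "good (1 - \<gamma>) (\<beta> * u + \<alpha> - n + \<gamma>) (\<beta> * v + \<alpha> - n + \<gamma>)"
    by (rule good_minus[OF assms(1) i, of "n - 1"])
      (use n u uv gamma_bounds in auto)
  with n u that show ?thesis by blast
qed

text \<open>
  Since the image lies in an interval of length \<open>\<gamma> = \<beta> * \<gamma>\<^sup>2\<close>.
\<close>

lemma good_length_le:
  assumes "good h u v" "\<beta> * h - \<gamma> \<in> \<int>"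
  shows "v - u \<le> \<gamma>^2"
proof -
  obtain n where "n - \<gamma> \<le> \<beta> * u + \<alpha>" "\<beta> * v + \<alpha> \<le> n"
    using good_into_B[OF assms] by blast
  then have "\<beta> * (v - u) \<le> \<gamma>" by (simp add: algebra_simps)
  then have "\<beta> * (v - u) \<le> \<beta> * \<gamma>^2" using beta_times_gamma_sq by simp
  then show ?thesis using beta_gt_1 by simp
qed

text \<open>
  Including 0 makes the supremum well defined when there is no good interval.
\<close>

definition max_length :: "real \<Rightarrow> real" where
  "max_length h = Sup (insert 0 {v - u | u v. good h u v})"

lemma bdd_above_lengths: "0 < h \<Longrightarrow> bdd_above (insert 0 {v - u | u v. good h u v})"
  by (rule bdd_aboveI[of _ 1]) (use good_range in force)

lemma length_le_max_length: "0 < h \<Longrightarrow> good h u v \<Longrightarrow> v - u \<le> max_length h"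
  unfolding max_length_def by (rule cSup_upper[OF _ bdd_above_lengths]) auto

lemma max_length_nonneg: "0 < h \<Longrightarrow> 0 \<le> max_length h"
  unfolding max_length_def by (rule cSup_upper[OF _ bdd_above_lengths]) auto

lemma max_length_le:
  assumes "\<And>u v. good h u v \<Longrightarrow> \<beta> * (v - u) \<le> x" "0 \<le> x"
  shows "\<beta> * max_length h \<le> x"
proof -
  have "max_length h \<le> x / \<beta>"
    unfolding max_length_def
  proof (rule cSup_least)
    fix z assume "z \<in> insert 0 {v - u | u v. good h u v}"
    then have "\<beta> * z \<le> x" using assms by auto
    then show "z \<le> x / \<beta>" using beta_gt_1 by (simp add: pos_le_divide_eq mult.commute)
  qed simp
  then show ?thesis using beta_gt_1 by (simp add: field_simps)
qed

lemma max_length_into_B: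
  assumes "0 < h" "\<beta> * h - \<gamma> \<in> \<int>"
  shows "\<beta> * max_length h \<le> max_length (1 - \<gamma>)"
proof (rule max_length_le)
  show "0 \<le> max_length (1 - \<gamma>)" using max_length_nonneg gamma_bounds by simp
  fix u v assume "good h u v"
  then obtain n where "good (1 - \<gamma>) (\<beta> * u + \<alpha> - n + \<gamma>) (\<beta> * v + \<alpha> - n + \<gamma>)"
    using good_into_B assms by blast
  from length_le_max_length[OF _ this] gamma_bounds show "\<beta> * (v - u) \<le> max_length (1 - \<gamma>)"
    by (simp add: algebra_simps)
qed

text \<open>
  Seen modulo 1, the circle consists of two arcs, of lengths \<open>1 - h'\<close> and \<open>h'\<close>, where the new gap is \<open>h'\<close>
  and \<open>1 - h'\<close> respectively.  An image that covers neither arc completely meets each at most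
  once, so it is cut into at most two pieces, one in each gap.
\<close>

lemma max_length_split:
  assumes h: "\<beta> * h - h' \<in> \<int>" "0 < h'" "h' < 1"
    and nowhole: "\<not> good h' 0 (1 - h')" "\<not> good (1 - h') 0 h'"
  shows "\<beta> * max_length h \<le> max_length h' + max_length (1 - h')"
proof (rule max_length_le)
  show "0 \<le> max_length h' + max_length (1 - h')" using max_length_nonneg[of h'] max_length_nonneg[of "1 - h'"] h by simp
  fix u v assume g: "good h u v"
  have "\<beta> * h + (1 - h') = (\<beta> * h - h') + 1" by simp
  then have i: "\<beta> * h + (1 - h') \<in> \<int>" using h(1) by (metis Ints_1 Ints_add)
  define p where "p = \<beta> * u + \<alpha>"
  define q where "q = \<beta> * v + \<alpha>"
  define n :: real where "n = of_int \<lfloor>p\<rfloor>"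
  have n: "n \<in> \<int>" "n \<le> p" "p < n + 1" unfolding n_def by (simp, linarith+)
  have uv: "p < q"
    using good_range[OF g] beta_gt_1 by (simp add: p_def q_def)
  have P: "good h' (x - m) (y - m)" if "m \<in> \<int>" "p \<le> x" "x < y" "y \<le> q" "m \<le> x" "y \<le> m + 1 - h'" for m x y
    by (rule good_plus[OF g h(1) that(1)]) (use that h in \<open>auto simp: p_def q_def\<close>)
  have M: "good (1 - h') (x - m - (1 - h')) (y - m - (1 - h'))" if "m \<in> \<int>" "p \<le> x" "x < y" "y \<le> q"
    "m + 1 - h' \<le> x" "y \<le> m + 1" for m x y
    by (rule good_minus[OF g i that(1)]) (use that h in \<open>auto simp: p_def q_def\<close>)
  have P': "y - x \<le> max_length h'" if "m \<in> \<int>" "p \<le> x" "x \<le> y" "y \<le> q" "m \<le> x" "y \<le> m + 1 - h'" for m x y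
    using length_le_max_length[OF h(2) P[OF that(1,2)_ that(4-6)]] max_length_nonneg[of h'] h that by (cases "x = y") auto
  have M': "y - x \<le> max_length (1 - h')" if "m \<in> \<int>" "p \<le> x" "x \<le> y" "y \<le> q"
    "m + 1 - h' \<le> x" "y \<le> m + 1" for m x y
    using length_le_max_length[OF _ M[OF that(1,2)_ that(4-6)]] max_length_nonneg[of "1 - h'"] h that by (cases "x = y") auto
  have "q - p \<le> max_length h' + max_length (1 - h')"
  proof (cases "p \<le> n + 1 - h'")
    case True
    have "q < n + 1"
    proof (rule ccontr)
      assume "\<not> q < n + 1"
      then show False using M[of n "n + 1 - h'" "n + 1"] n True nowhole h by simp
    qed
    show ?thesis
    proof (cases "q \<le> n + 1 - h'")
      case True
      then show ?thesis using P'[of n p q] n uv max_length_nonneg[of "1 - h'"] h by simp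
    next
      case False
      then show ?thesis using P'[of n p "n + 1 - h'"] M'[of n "n + 1 - h'" q] n True \<open>q < n + 1\<close> by simp
    qed
  next
    case False
    have "q < n + 1 + 1 - h'"
    proof (rule ccontr)
      assume "\<not> q < n + 1 + 1 - h'"
      then show False using P[of "n + 1" "n + 1" "n + 1 + 1 - h'"] n nowhole h by simp
    qed
    show ?thesis
    proof (cases "q \<le> n + 1")
      case True
      then show ?thesis using M'[of n p q] n uv max_length_nonneg[of "h'"] h False by simp
    next
      case q: False
      then show ?thesis using M'[of n p "n + 1"] P'[of "n + 1" "n + 1" q] n False \<open>q < n + 1 + 1 - h'\<close> by simp
    qed
  qed
  then show "\<beta> * (v - u) \<le> max_length h' + max_length (1 - h')" by (simp add: p_def q_def algebra_simps)
qed


lemma no_whole_D: "\<not> good (\<gamma>^2) 0 (1 - \<gamma>^2)"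
  using good_length_le[OF _ gap_ints(5), of 0 "1 - \<gamma>^2"] gamma_bounds by force

text \<open>
  The image of all of \<open>C\<close> covers an interval in \<open>D\<close> that is too long for \<open>good_length_le\<close>.
\<close>

lemma no_whole_C: "\<not> good (\<gamma>^3) 0 (1 - \<gamma>^3)"
proof
  assume g: "good (\<gamma>^3) 0 (1 - \<gamma>^3)"
  have "\<beta> * (1 - \<gamma>^3) = 1 + \<gamma>" using beta_eq beta_gamma_cube unfolding right_diff_distrib by linarith
  then have "good (\<gamma>^2) 0 \<gamma>"
    by (intro good_plus[OF g gap_ints(3), of 1]) (use gamma_bounds alpha_range in auto)
  from good_length_le[OF this gap_ints(5)] gamma_bounds show False by simp
qed

text \<open>
  No good interval fills \<open>C\<close> or \<open>D\<close>.  If none fills \<open>A\<close> or \<open>E\<close> either, then the greatest lengths satisfy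
  \<open>\<beta> * L\<^sub>A \<le> L\<^sub>B\<close>, \<open>\<beta> * L\<^sub>D \<le> L\<^sub>B\<close>, \<open>\<beta> * L\<^sub>B \<le> L\<^sub>A + L\<^sub>C\<close>, \<open>\<beta> * L\<^sub>C \<le> L\<^sub>D + L\<^sub>E\<close> and \<open>\<beta> * L\<^sub>E \<le> L\<^sub>D + L\<^sub>E\<close>.  Eliminating
  everything but \<open>L\<^sub>B\<close> gives \<open>\<beta> * (\<beta> - 1) * L\<^sub>B \<le> L\<^sub>B\<close>, and \<open>\<beta> * (\<beta> - 1) > 1\<close>; hence all of them vanish.
\<close>

lemma whole_A_or_E:
  assumes "h \<in> gaps" "good h u v"
  shows "good (1 - \<gamma>^3) 0 (\<gamma>^3) \<or> good (1 - \<gamma>^2) 0 (\<gamma>^2)"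
proof (rule ccontr)
  assume "\<not> ?thesis"
  then have nA: "\<not> good (1 - \<gamma>^3) 0 (\<gamma>^3)" and nE: "\<not> good (1 - \<gamma>^2) 0 (\<gamma>^2)" by auto
  note b = gamma_bounds gamma_cube_bounds
  have A: "\<beta> * max_length (1 - \<gamma>^3) \<le> max_length (1 - \<gamma>)" and D: "\<beta> * max_length (\<gamma>^2) \<le> max_length (1 - \<gamma>)"
    using max_length_into_B[OF _ gap_ints(1)] max_length_into_B[OF _ gap_ints(5)] b by auto
  have B: "\<beta> * max_length (1 - \<gamma>) \<le> max_length (1 - \<gamma>^3) + max_length (\<gamma>^3)"
    using max_length_split[OF gap_ints(2)] nA no_whole_C b by simp
  have C: "\<beta> * max_length (\<gamma>^3) \<le> max_length (\<gamma>^2) + max_length (1 - \<gamma>^2)"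
    using max_length_split[OF gap_ints(3)] nE no_whole_D b by simp
  have E: "\<beta> * max_length (1 - \<gamma>^2) \<le> max_length (\<gamma>^2) + max_length (1 - \<gamma>^2)"
    using max_length_split[OF gap_ints(4)] nE no_whole_D b by simp
  have nn: "0 \<le> max_length (1 - \<gamma>^3)" "0 \<le> max_length (1 - \<gamma>)" "0 \<le> max_length (\<gamma>^3)" "0 \<le> max_length (\<gamma>^2)" "0 \<le> max_length (1 - \<gamma>^2)"
    using max_length_nonneg b by auto
  have num: "183/100 * x \<le> \<beta> * x" if "0 \<le> x" for x
    using that beta_bounds by (intro mult_right_mono) auto
  note num[OF nn(1)] num[OF nn(2)] num[OF nn(3)] num[OF nn(4)] num[OF nn(5)]
  then have "max_length (1 - \<gamma>) \<le> 0" using A B C D E by linarith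
  then have "max_length (1 - \<gamma>^3) = 0 \<and> max_length (1 - \<gamma>) = 0 \<and> max_length (\<gamma>^3) = 0 \<and> max_length (\<gamma>^2) = 0 \<and> max_length (1 - \<gamma>^2) = 0"
    using A B C D E nn num[OF nn(1)] num[OF nn(3)] num[OF nn(4)] num[OF nn(5)]
    by (intro conjI; linarith)
  then have "max_length h = 0" using assms(1) by (auto simp: gaps_def)
  moreover have "0 < h" using assms(1) b by (auto simp: gaps_def)
  ultimately show False using length_le_max_length[OF _ assms(2)] good_range[OF assms(2)] by simp
qed

text \<open>
  One passage \<open>B \<rightarrow> C \<rightarrow> D \<rightarrow> B\<close> of the part of the interval that ends at the top of \<open>C\<close> and then at the top
  of \<open>D\<close>.  The upper end \<open>\<alpha> - \<gamma>\<^sup>3\<close> is reproduced, because it is the image of the top of \<open>D\<close>; the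
  lower end moves by an affine map with slope \<open>\<beta>\<^sup>3\<close>.
\<close>

lemma anchored_step:
  assumes a: "1 - \<gamma> \<le> \<alpha>" and g: "good (1 - \<gamma>) s (\<alpha> - \<gamma>^3)" and s: "s \<le> \<alpha> - 1 + \<gamma>"
  shows "good (1 - \<gamma>) (\<beta>^3 * s + \<beta>^3 * \<alpha> - \<beta> - 2) (\<alpha> - \<gamma>^3)"
proof -
  note b = gamma_bounds gamma_cube_bounds
  have s0: "0 \<le> s" using good_range[OF g] by simp
  have bs: "\<beta> * s \<le> \<beta> * \<alpha> - \<beta> + 1"
    using mult_left_mono[OF s, of \<beta>] beta_gt_1 beta_gamma by (simp add: algebra_simps)
  have ba: "\<beta> * \<alpha> < 1" using alpha_range beta_gt_1 beta_gamma
    by (metis less_trans mult_strict_left_mono zero_less_one)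
  have ba': "\<beta> - 1 \<le> \<beta> * \<alpha>"
    using mult_left_mono[OF a, of \<beta>] beta_gt_1 beta_gamma by (simp add: algebra_simps)
  have C: "good (\<gamma>^3) (\<beta> * s + \<alpha> - \<gamma>^3) (1 - \<gamma>^3)"
  proof (rule good_minus[OF g, of _ 0])
    have "\<beta> * (1 - \<gamma>) + \<gamma>^3 = 1" using beta_gamma beta_eq gamma_cubic unfolding right_diff_distrib by linarith
    then show "\<beta> * (1 - \<gamma>) + \<gamma>^3 \<in> \<int>" by (simp only: Ints_1)
    show "0 + \<gamma>^3 + (1 - \<gamma>^3) \<le> \<beta> * (\<alpha> - \<gamma>^3) + \<alpha>"
      using ba' a beta_gamma_cube beta_eq gamma_cubic unfolding right_diff_distrib by linarith
    show "0 \<le> \<beta> * s + \<alpha> - \<gamma>^3" using mult_nonneg_nonneg[of \<beta> s] s0 a b beta_gt_1 by linarith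
    show "\<beta> * s + \<alpha> - \<gamma>^3 < 1 - \<gamma>^3" using bs ba alpha_range beta_bounds b by linarith
  qed (use b in auto)
  define t where "t = \<beta> * (\<beta> * s + \<alpha> - \<gamma>^3) + \<alpha>"
  have t: "t < 2 - \<gamma>^2"
  proof -
    have "\<beta> * (\<beta> * s) \<le> \<beta> * (\<beta> * \<alpha> - \<beta> + 1)" using bs beta_gt_1 by simp
    moreover have "\<beta> * (\<beta> * \<alpha>) \<le> \<beta>" using ba beta_gt_1 by simp
    ultimately have "t \<le> \<beta> - \<beta>*\<beta> + \<beta> + 1 - \<gamma>^2 + \<alpha>" using ba beta_gamma_cube
      by (simp add: t_def algebra_simps)
    moreover have "\<beta> * \<beta> = \<beta> + 1 + \<gamma>" using beta_sq by (simp add: power2_eq_square)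
    ultimately show ?thesis using b alpha_range beta_eq by linarith
  qed
  have top: "\<beta> * (1 - \<gamma>^3) + \<alpha> = 1 + \<gamma> + \<alpha>"
    using beta_eq beta_gamma_cube unfolding right_diff_distrib by linarith
  have t1: "1 < t"
  proof (rule ccontr)
    assume "\<not> 1 < t"
    then have "good (\<gamma>^2) 0 (1 - \<gamma>^2)"
      by (intro good_plus[OF C gap_ints(3), of 1]) (use t_def top a b in auto)
    then show False using no_whole_D by simp
  qed
  have D: "good (\<gamma>^2) (t - 1) (1 - \<gamma>^2)"
    by (rule good_plus[OF C gap_ints(3), of 1]) (use t_def top a b t t1 in auto)
  obtain n where n: "n \<in> \<int>" "n - \<gamma> \<le> \<beta> * (t - 1) + \<alpha>" "\<beta> * (1 - \<gamma>^2) + \<alpha> \<le> n"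
    and gB: "good (1 - \<gamma>) (\<beta> * (t - 1) + \<alpha> - n + \<gamma>) (\<beta> * (1 - \<gamma>^2) + \<alpha> - n + \<gamma>)"
    using good_into_B[OF D gap_ints(5)] by blast
  have top2: "\<beta> * (1 - \<gamma>^2) = 1 + \<gamma>^2"
    using beta_eq beta_times_gamma_sq unfolding right_diff_distrib by linarith
  have "\<beta> * (t - 1) + \<alpha> < 1 + \<gamma>^2 + \<alpha>"
    using good_range[OF gB] top2 by simp
  then have "1 < n" "n < 3" using n top2 a b alpha_range by auto
  then have "n = 2" using n(1) by (auto elim!: Ints_cases)
  moreover have "\<beta> * (1 - \<gamma>^2) + \<alpha> - 2 + \<gamma> = \<alpha> - \<gamma>^3" using top2 gamma_cubic by simp
  moreover have "\<beta> * (t - 1) + \<alpha> - 2 + \<gamma> = \<beta>^3 * s + \<beta>^3 * \<alpha> - \<beta> - 2"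
  proof -
    have "\<beta> * (t - 1) = \<beta>^3 * s + (\<beta>^2 + \<beta>) * \<alpha> - \<beta> * (\<beta> * \<gamma>^3) - \<beta>"
      by (simp add: t_def algebra_simps power2_eq_square power3_eq_cube)
    then show ?thesis using beta_gamma_cube beta_times_gamma_sq beta_cubic by (simp add: algebra_simps)
  qed
  ultimately show ?thesis using gB \<open>n = 2\<close> by metis
qed

text \<open>
  For \<open>\<alpha> = \<gamma>\<close> the point \<open>\<alpha> - 1 + \<gamma>\<close> is fixed by the affine map of \<open>anchored_step\<close>.  For \<open>\<alpha> < \<gamma>\<close> the map
  takes every point from there downwards to a point lower by at least a fixed amount, so that the
  interval would eventually reach below 0.
\<close>

lemma anchored_False:
  assumes a: "1 - \<gamma> \<le> \<alpha>" and g: "good (1 - \<gamma>) s (\<alpha> - \<gamma>^3)" and s: "s \<le> \<alpha> - 1 + \<gamma>"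
  shows False
proof -
  define c where "c = (2 * \<beta>^3 - 1) * (\<gamma> - \<alpha>)"
  have b3: "1 \<le> \<beta>^3" using beta_gt_1 by simp
  then have c: "0 < c" using alpha_range by (simp add: c_def)
  \<comment> \<open>The step of \<open>anchored_step\<close> vanishes at \<open>\<alpha> = \<gamma>\<close>, \<open>s = \<alpha> - 1 + \<gamma>\<close>.\<close>
  have eq: "(2 * \<beta>^3 - 1) * \<gamma> - (\<beta>^3 - 1) * (1 - \<gamma>) - \<beta> - 2 = 0"
  proof -
    have "\<beta>^3 * \<gamma> = \<beta>^2 * (\<beta> * \<gamma>)" by (simp add: power2_eq_square power3_eq_cube)
    then have "\<beta>^3 * \<gamma> = \<beta>^2" using beta_gamma by simp
    then show ?thesis using beta_cubic beta_sq by (simp add: algebra_simps)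
  qed
  have "\<exists>s. good (1 - \<gamma>) s (\<alpha> - \<gamma>^3) \<and> s \<le> \<alpha> - 1 + \<gamma> - of_nat k * c" for k
  proof (induction k)
    case 0
    then show ?case using g s by auto
  next
    case (Suc k)
    then obtain s where s: "good (1 - \<gamma>) s (\<alpha> - \<gamma>^3)" "s \<le> \<alpha> - 1 + \<gamma> - of_nat k * c" by blast
    have s': "s \<le> \<alpha> - 1 + \<gamma>"
      using s(2) mult_nonneg_nonneg[of "of_nat k" c] c by linarith
    have "(\<beta>^3 - 1) * s \<le> (\<beta>^3 - 1) * (\<alpha> - 1 + \<gamma>)" using s' b3 by (intro mult_left_mono) auto
    then have "\<beta>^3 * s + \<beta>^3 * \<alpha> - \<beta> - 2 \<le> s - c"
      using eq by (simp add: c_def algebra_simps)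
    then have "\<beta>^3 * s + \<beta>^3 * \<alpha> - \<beta> - 2 \<le> \<alpha> - 1 + \<gamma> - of_nat (Suc k) * c"
      using s(2) by (simp add: algebra_simps)
    then show ?case using anchored_step[OF a s(1) s'] by blast
  qed
  moreover obtain k :: nat where "2 < of_nat k * c"
    using c reals_Archimedean3 by blast
  ultimately obtain s where s: "good (1 - \<gamma>) s (\<alpha> - \<gamma>^3)" "s \<le> \<alpha> - 1 + \<gamma> - 2"
    by (meson diff_left_mono less_imp_le order_trans)
  from s(2) alpha_range gamma_bounds have "s < 0" by linarith
  with good_range[OF s(1)] show False by linarith
qed

text \<open>
  If the image of all of \<open>A\<close> lies in \<open>B\<close>, it is exactly the interval from \<open>\<alpha> - 1 + \<gamma>\<close> to \<open>\<alpha> - \<gamma>\<^sup>3\<close>.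
\<close>

lemma not_whole_A: "\<not> good (1 - \<gamma>^3) 0 (\<gamma>^3)"
proof
  assume g: "good (1 - \<gamma>^3) 0 (\<gamma>^3)"
  obtain n where n: "n \<in> \<int>" "n - \<gamma> \<le> \<alpha>" "\<beta> * \<gamma>^3 + \<alpha> \<le> n"
    and gB: "good (1 - \<gamma>) (\<alpha> - n + \<gamma>) (\<beta> * \<gamma>^3 + \<alpha> - n + \<gamma>)"
    using good_into_B[OF g gap_ints(1)] by auto
  have "0 < n" "n < 2" using n beta_gamma_cube gamma_bounds alpha_range by auto
  then have n1: "n = 1" using n(1) by (auto elim!: Ints_cases)
  have top: "\<beta> * \<gamma>^3 + \<alpha> - 1 + \<gamma> = \<alpha> - \<gamma>^3" using beta_gamma_cube gamma_cubic by simp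
  have "good (1 - \<gamma>) (\<alpha> - 1 + \<gamma>) (\<alpha> - \<gamma>^3)" using gB unfolding n1 top .
  then show False using anchored_False[of "\<alpha> - 1 + \<gamma>"] n(2) n1 by simp
qed

text \<open>
  The image of \<open>E\<close> contains the part of \<open>D\<close> above \<open>\<alpha>\<close>; this part must go uncut to \<open>B\<close>.  If the image
  does not reach the top of \<open>D\<close>, its length \<open>\<gamma>\<close> is too large for that; otherwise there is no choice for
  the integer part, and an interval as in \<open>anchored_False\<close> results.
\<close>

lemma not_whole_E: "\<not> good (1 - \<gamma>^2) 0 (\<gamma>^2)"
proof
  assume g: "good (1 - \<gamma>^2) 0 (\<gamma>^2)"
  note b = gamma_bounds gamma_cube_bounds
  have "\<not> good (\<gamma>^2) \<alpha> (\<alpha> + \<gamma>)" using good_length_le[OF _ gap_ints(5)] b by force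
  moreover have "good (\<gamma>^2) \<alpha> (\<alpha> + \<gamma>)" if "\<alpha> + \<gamma> \<le> 1 - \<gamma>^2"
    by (rule good_plus[OF g gap_ints(4), of 0]) (use that b alpha_range beta_times_gamma_sq in auto)
  ultimately have a: "1 - \<gamma>^2 < \<alpha> + \<gamma>" by fastforce
  have D: "good (\<gamma>^2) \<alpha> (1 - \<gamma>^2)"
    by (rule good_plus[OF g gap_ints(4), of 0]) (use a b alpha_range beta_times_gamma_sq in auto)
  obtain n where n: "n \<in> \<int>" "n - \<gamma> \<le> \<beta> * \<alpha> + \<alpha>" "\<beta> * (1 - \<gamma>^2) + \<alpha> \<le> n"
    and gB: "good (1 - \<gamma>) (\<beta> * \<alpha> + \<alpha> - n + \<gamma>) (\<beta> * (1 - \<gamma>^2) + \<alpha> - n + \<gamma>)"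
    using good_into_B[OF D gap_ints(5)] by blast
  have top2: "\<beta> * (1 - \<gamma>^2) = 1 + \<gamma>^2"
    using beta_eq beta_times_gamma_sq unfolding right_diff_distrib by linarith
  have ba: "\<beta> * \<alpha> < 1" using alpha_range beta_gt_1 beta_gamma
    by (metis less_trans mult_strict_left_mono zero_less_one)
  have "1 < n" "n < 3" using n ba top2 a b alpha_range by auto
  then have n2: "n = 2" using n(1) by (auto elim!: Ints_cases)
  have "1 - \<gamma> \<le> \<alpha>"
  proof (rule ccontr)
    assume "\<not> 1 - \<gamma> \<le> \<alpha>"
    then have "\<beta> * \<alpha> \<le> \<beta> * (1 - \<gamma>)" using beta_gt_1 by simp
    then have "\<beta> * \<alpha> \<le> \<beta> - 1" using beta_gamma by (simp add: algebra_simps)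
    then show False using n(2) n2 \<open>\<not> 1 - \<gamma> \<le> \<alpha>\<close> b beta_bounds by linarith
  qed
  moreover have top: "\<beta> * (1 - \<gamma>^2) + \<alpha> - 2 + \<gamma> = \<alpha> - \<gamma>^3" using top2 gamma_cubic by simp
  moreover have "good (1 - \<gamma>) (\<beta> * \<alpha> + \<alpha> - 2 + \<gamma>) (\<alpha> - \<gamma>^3)"
    using gB unfolding n2 top .
  ultimately show False using anchored_False[of "\<beta> * \<alpha> + \<alpha> - 2 + \<gamma>"] ba by simp
qed

theorem no_good:
  assumes "h \<in> gaps"
  shows "\<not> good h u v"
  using whole_A_or_E[OF assms] not_whole_A not_whole_E by blast

end

section \<open>Every interval of pairs contains a pair that matches\<close>

text \<open>
  The map \<open>gen_beta_map\<close> is discontinuous exactly where its value is 0.  Requiring that the two orbits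
  avoid 0 until they meet makes matching an open condition on the parameter and the points.
\<close>

definition robustly_match :: "real \<Rightarrow> real \<Rightarrow> real \<Rightarrow> real \<Rightarrow> bool" where
  "robustly_match \<alpha> \<beta> x y \<longleftrightarrow>
     (\<exists>k. (gen_beta_map \<alpha> \<beta> ^^ k) x = (gen_beta_map \<alpha> \<beta> ^^ k) y \<and>
          (\<forall>j\<in>{1..k}. (gen_beta_map \<alpha> \<beta> ^^ j) x \<noteq> 0 \<and> (gen_beta_map \<alpha> \<beta> ^^ j) y \<noteq> 0))"

lemma robustly_match_sym: "robustly_match \<alpha> \<beta> x y \<Longrightarrow> robustly_match \<alpha> \<beta> y x"
  unfolding robustly_match_def by metis

lemma robustly_match_step:
  assumes "robustly_match \<alpha> \<beta> (gen_beta_map \<alpha> \<beta> x) (gen_beta_map \<alpha> \<beta> y)"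
    and "gen_beta_map \<alpha> \<beta> x \<noteq> 0" "gen_beta_map \<alpha> \<beta> y \<noteq> 0"
  shows "robustly_match \<alpha> \<beta> x y"
proof -
  let ?T = "gen_beta_map \<alpha> \<beta>"
  obtain k where k: "(?T ^^ k) (?T x) = (?T ^^ k) (?T y)"
    "\<And>j. j \<in> {1..k} \<Longrightarrow> (?T ^^ j) (?T x) \<noteq> 0 \<and> (?T ^^ j) (?T y) \<noteq> 0"
    using assms(1) unfolding robustly_match_def by blast
  have "(?T ^^ j) x \<noteq> 0 \<and> (?T ^^ j) y \<noteq> 0" if "j \<in> {1..Suc k}" for j
  proof (cases j)
    case (Suc i)
    then show ?thesis using k(2)[of i] that assms(2,3)
      by (cases "i = 0") (auto simp: funpow_Suc_right simp del: funpow.simps(2))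
  qed (use that in auto)
  then show ?thesis unfolding robustly_match_def using k(1)
    by (intro exI[of _ "Suc k"]) (simp add: funpow_Suc_right del: funpow.simps(2))
qed

lemma gen_beta_map_eqI:
  assumes "\<beta> * x + \<alpha> - z \<in> \<int>" "0 \<le> z" "z < 1"
  shows "gen_beta_map \<alpha> \<beta> x = z"
  unfolding gen_beta_map_def using assms by (simp add: frac_unique_iff)

text \<open>
  Away from the discontinuities the integer parts along both orbits are locally constant.  The
  difference of the two orbits depends only on these and on \<open>h\<close>, so it remains 0 at time \<open>k\<close>.
\<close>

lemma robustly_match_open:
  assumes "robustly_match \<alpha>0 \<beta> x0 (x0 + h)"
  shows "\<exists>\<epsilon>>0. \<forall>\<alpha> x. \<bar>\<alpha> - \<alpha>0\<bar> < \<epsilon> \<longrightarrow> \<bar>x - x0\<bar> < \<epsilon> \<longrightarrow>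
    (\<exists>k. (gen_beta_map \<alpha> \<beta> ^^ k) x = (gen_beta_map \<alpha> \<beta> ^^ k) (x + h))"
proof -
  let ?T = "\<lambda>\<alpha> j x. (gen_beta_map \<alpha> \<beta> ^^ j) x"
  let ?F = "nhds \<alpha>0 \<times>\<^sub>F nhds x0"
  obtain k where k: "?T \<alpha>0 k x0 = ?T \<alpha>0 k (x0 + h)"
    "\<And>j. j \<in> {1..k} \<Longrightarrow> ?T \<alpha>0 j x0 \<noteq> 0 \<and> ?T \<alpha>0 j (x0 + h) \<noteq> 0"
    using assms unfolding robustly_match_def by blast
  have a: "(fst \<longlongrightarrow> \<alpha>0) ?F" and x: "(snd \<longlongrightarrow> x0) ?F"
    by (simp_all add: filterlim_fst filterlim_snd)
  \<comment> \<open>Where the value is not 0, the map is continuous and its integer part locally constant.\<close>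
  have step: "((\<lambda>w. gen_beta_map (fst w) \<beta> (f w)) \<longlongrightarrow> gen_beta_map \<alpha>0 \<beta> l) ?F
      \<and> (\<forall>\<^sub>F w in ?F. gen_beta_map (fst w) \<beta> (f w) = \<beta> * f w + fst w - of_int \<lfloor>\<beta> * l + \<alpha>0\<rfloor>)"
    if f: "(f \<longlongrightarrow> l) ?F" and nz: "gen_beta_map \<alpha>0 \<beta> l \<noteq> 0" for f l
  proof -
    have lim: "((\<lambda>w. \<beta> * f w + fst w) \<longlongrightarrow> \<beta> * l + \<alpha>0) ?F"
      by (intro tendsto_intros f a)
    have "of_int \<lfloor>\<beta> * l + \<alpha>0\<rfloor> < \<beta> * l + \<alpha>0" "\<beta> * l + \<alpha>0 < of_int \<lfloor>\<beta> * l + \<alpha>0\<rfloor> + 1"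
      using nz unfolding gen_beta_map_def frac_def by linarith+
    from order_tendstoD(1)[OF lim this(1)] order_tendstoD(2)[OF lim this(2)]
    have ev: "\<forall>\<^sub>F w in ?F. gen_beta_map (fst w) \<beta> (f w) = \<beta> * f w + fst w - of_int \<lfloor>\<beta> * l + \<alpha>0\<rfloor>"
    proof eventually_elim
      case (elim w)
      then have "\<lfloor>\<beta> * f w + fst w\<rfloor> = \<lfloor>\<beta> * l + \<alpha>0\<rfloor>" by (intro floor_unique) auto
      then show ?case by (simp add: gen_beta_map_def frac_def)
    qed
    have "((\<lambda>w. \<beta> * f w + fst w - of_int \<lfloor>\<beta> * l + \<alpha>0\<rfloor>) \<longlongrightarrow> gen_beta_map \<alpha>0 \<beta> l) ?F"
      unfolding gen_beta_map_def frac_def by (intro tendsto_intros lim)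
    then show ?thesis using ev by (auto simp: tendsto_cong[OF ev])
  qed
  have "((\<lambda>w. ?T (fst w) j (snd w)) \<longlongrightarrow> ?T \<alpha>0 j x0) ?F \<and>
        ((\<lambda>w. ?T (fst w) j (snd w + h)) \<longlongrightarrow> ?T \<alpha>0 j (x0 + h)) ?F \<and>
        (\<forall>\<^sub>F w in ?F. ?T (fst w) j (snd w + h) - ?T (fst w) j (snd w) =
                      ?T \<alpha>0 j (x0 + h) - ?T \<alpha>0 j x0)" if "j \<le> k" for j
    using that
  proof (induction j)
    case 0
    then show ?case by (auto intro!: tendsto_intros x)
  next
    case (Suc j)
    then have nz: "?T \<alpha>0 (Suc j) x0 \<noteq> 0" "?T \<alpha>0 (Suc j) (x0 + h) \<noteq> 0" using k(2)[of "Suc j"] by simp_all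
    from Suc have l1: "((\<lambda>w. ?T (fst w) j (snd w)) \<longlongrightarrow> ?T \<alpha>0 j x0) ?F"
      and l2: "((\<lambda>w. ?T (fst w) j (snd w + h)) \<longlongrightarrow> ?T \<alpha>0 j (x0 + h)) ?F"
      and e: "\<forall>\<^sub>F w in ?F. ?T (fst w) j (snd w + h) - ?T (fst w) j (snd w) =
                      ?T \<alpha>0 j (x0 + h) - ?T \<alpha>0 j x0" by auto
    have s1: "((\<lambda>w. ?T (fst w) (Suc j) (snd w)) \<longlongrightarrow> ?T \<alpha>0 (Suc j) x0) ?F"
        "\<forall>\<^sub>F w in ?F. ?T (fst w) (Suc j) (snd w) = \<beta> * ?T (fst w) j (snd w) + fst w - of_int \<lfloor>\<beta> * ?T \<alpha>0 j x0 + \<alpha>0\<rfloor>"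
      using step[OF l1] nz(1) by auto
    have s2: "((\<lambda>w. ?T (fst w) (Suc j) (snd w + h)) \<longlongrightarrow> ?T \<alpha>0 (Suc j) (x0 + h)) ?F"
        "\<forall>\<^sub>F w in ?F. ?T (fst w) (Suc j) (snd w + h) = \<beta> * ?T (fst w) j (snd w + h) + fst w - of_int \<lfloor>\<beta> * ?T \<alpha>0 j (x0 + h) + \<alpha>0\<rfloor>"
      using step[OF l2] nz(2) by auto
    have "\<forall>\<^sub>F w in ?F. ?T (fst w) (Suc j) (snd w + h) - ?T (fst w) (Suc j) (snd w) =
                      ?T \<alpha>0 (Suc j) (x0 + h) - ?T \<alpha>0 (Suc j) x0"
      using s1(2) s2(2) e
    proof eventually_elim
      case (elim w)
      have "?T (fst w) (Suc j) (snd w + h) - ?T (fst w) (Suc j) (snd w)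
        = \<beta> * (?T (fst w) j (snd w + h) - ?T (fst w) j (snd w))
          - of_int \<lfloor>\<beta> * ?T \<alpha>0 j (x0 + h) + \<alpha>0\<rfloor> + of_int \<lfloor>\<beta> * ?T \<alpha>0 j x0 + \<alpha>0\<rfloor>"
        unfolding elim(1,2) by (simp add: algebra_simps)
      also have "\<dots> = ?T \<alpha>0 (Suc j) (x0 + h) - ?T \<alpha>0 (Suc j) x0"
        unfolding elim(3) by (simp add: gen_beta_map_def frac_def algebra_simps)
      finally show ?case .
    qed
    with s1(1) s2(1) show ?case by blast
  qed
  from this[OF order_refl]
  have "\<forall>\<^sub>F w in ?F. ?T (fst w) k (snd w + h) - ?T (fst w) k (snd w) = 0"
    using k(1) by simp
  then have "\<forall>\<^sub>F w in ?F. ?T (fst w) k (snd w) = ?T (fst w) k (snd w + h)"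
    by eventually_elim simp
  then have "\<forall>\<^sub>F w in nhds (\<alpha>0, x0). ?T (fst w) k (snd w) = ?T (fst w) k (snd w + h)"
    by (simp add: nhds_prod)
  then obtain d where d: "d > 0" "\<And>w. dist w (\<alpha>0, x0) < d \<Longrightarrow> ?T (fst w) k (snd w) = ?T (fst w) k (snd w + h)"
    unfolding eventually_nhds_metric by blast
  show ?thesis
  proof (intro exI[of _ "d/2"] conjI allI impI)
    fix \<alpha> x assume "\<bar>\<alpha> - \<alpha>0\<bar> < d/2" "\<bar>x - x0\<bar> < d/2"
    then have "dist (\<alpha>, x) (\<alpha>0, x0) < d"
      using sqrt_sum_squares_le_sum_abs[of "\<alpha> - \<alpha>0" "x - x0"] by (simp add: dist_Pair_Pair dist_real_def)
    from d(2)[OF this] show "\<exists>k. ?T \<alpha> k x = ?T \<alpha> k (x + h)" by auto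
  qed (use d in auto)
qed

context tribonacci
begin

definition surviving :: "real \<Rightarrow> real \<Rightarrow> real \<Rightarrow> real \<Rightarrow> bool" where
  "surviving \<alpha> h u v \<longleftrightarrow> 0 \<le> u \<and> u < v \<and> v \<le> 1 - h \<and>
     (\<forall>z. u < z \<longrightarrow> z < v \<longrightarrow> \<not> robustly_match \<alpha> \<beta> z (z + h))"

lemma surviving_range: "surviving \<alpha> h u v \<Longrightarrow> 0 \<le> u \<and> u < v \<and> v \<le> 1 - h"
  by (simp add: surviving_def)

lemma surviving_plus:
  assumes g: "surviving \<alpha> h u v" and h: "\<beta> * h - h' \<in> \<int>" "n \<in> \<int>" "0 < h'"
    and pq: "\<beta> * u + \<alpha> \<le> n + p" "n + q \<le> \<beta> * v + \<alpha>" "0 \<le> p" "p < q" "q \<le> 1 - h'"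
  shows "surviving \<alpha> h' p q"
  unfolding surviving_def
proof (intro conjI allI impI notI)
  fix z assume z: "p < z" "z < q" and m: "robustly_match \<alpha> \<beta> z (z + h')"
  define x where "x = (n + z - \<alpha>) / \<beta>"
  have x: "\<beta> * x = n + z - \<alpha>" using beta_gt_1 by (simp add: x_def)
  have "\<beta> * u < \<beta> * x" "\<beta> * x < \<beta> * v" using x z pq by linarith+
  then have ux: "u < x" "x < v" using beta_gt_1 by simp_all
  have T1: "gen_beta_map \<alpha> \<beta> x = z"
    by (rule gen_beta_map_eqI) (use x h z pq in auto)
  have "\<beta> * (x + h) + \<alpha> - (z + h') = n + (\<beta> * h - h')" using x by (simp add: algebra_simps)
  then have "\<beta> * (x + h) + \<alpha> - (z + h') \<in> \<int>" using h(1,2) by (metis Ints_add)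
  then have T2: "gen_beta_map \<alpha> \<beta> (x + h) = z + h'"
    by (rule gen_beta_map_eqI) (use h z pq in auto)
  have "robustly_match \<alpha> \<beta> x (x + h)"
    by (rule robustly_match_step) (use T1 T2 m z pq h in auto)
  then show False using g ux by (auto simp: surviving_def)
qed (use pq in auto)

lemma surviving_minus:
  assumes g: "surviving \<alpha> h u v" and h: "\<beta> * h + h' \<in> \<int>" "n \<in> \<int>" "0 < h'"
    and pq: "\<beta> * u + \<alpha> \<le> n + h' + p" "n + h' + q \<le> \<beta> * v + \<alpha>" "0 \<le> p" "p < q" "q \<le> 1 - h'"
  shows "surviving \<alpha> h' p q"
  unfolding surviving_def
proof (intro conjI allI impI notI)
  fix z assume z: "p < z" "z < q" and m: "robustly_match \<alpha> \<beta> z (z + h')"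
  define x where "x = (n + h' + z - \<alpha>) / \<beta>"
  have x: "\<beta> * x = n + h' + z - \<alpha>" using beta_gt_1 by (simp add: x_def)
  have "\<beta> * u < \<beta> * x" "\<beta> * x < \<beta> * v" using x z pq by linarith+
  then have ux: "u < x" "x < v" using beta_gt_1 by simp_all
  have T1: "gen_beta_map \<alpha> \<beta> x = z + h'"
    by (rule gen_beta_map_eqI) (use x h z pq in auto)
  have "\<beta> * (x + h) + \<alpha> - z = n + (\<beta> * h + h')" using x by (simp add: algebra_simps)
  then have "\<beta> * (x + h) + \<alpha> - z \<in> \<int>" using h(1,2) by (metis Ints_add)
  then have T2: "gen_beta_map \<alpha> \<beta> (x + h) = z"
    by (rule gen_beta_map_eqI) (use h z pq in auto)
  have "robustly_match \<alpha> \<beta> x (x + h)"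
    by (rule robustly_match_step) (use T1 T2 robustly_match_sym[OF m] z pq h in auto)
  then show False using g ux by (auto simp: surviving_def)
qed (use pq in auto)

text \<open>
  Every pair at distance \<open>\<gamma>\<close> has equal images since \<open>\<beta> * \<gamma> = 1\<close>; one only has to choose a pair whose
  image is not 0.
\<close>

lemma not_surviving_gamma: "\<not> surviving \<alpha> \<gamma> u v"
proof
  assume g: "surviving \<alpha> \<gamma> u v"
  define m where "m = (u + v) / 2"
  have m: "u < m" "m < v" using surviving_range[OF g] by (auto simp: m_def)
  have "\<exists>x. u < x \<and> x < v \<and> gen_beta_map \<alpha> \<beta> x \<noteq> 0"
  proof (cases "gen_beta_map \<alpha> \<beta> m = 0")
    case True
    define d where "d = min ((v - m) / 2) (1/4)"
    have d: "0 < d" "m + d < v" "d \<le> 1/4" using m by (auto simp: d_def min_def field_simps)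
    have "gen_beta_map \<alpha> \<beta> (m + d) = \<beta> * d"
    proof (rule gen_beta_map_eqI)
      have "\<beta> * m + \<alpha> \<in> \<int>" using True by (simp add: gen_beta_map_def)
      then show "\<beta> * (m + d) + \<alpha> - \<beta> * d \<in> \<int>" by (simp add: algebra_simps)
      show "0 \<le> \<beta> * d" using d beta_gt_1 by simp
      have "\<beta> * d \<le> 2 * (1/4)" using d beta_bounds by (intro mult_mono) auto
      then show "\<beta> * d < 1" by simp
    qed
    moreover have "\<beta> * d \<noteq> 0" using d beta_gt_1 by simp
    ultimately show ?thesis using d m by (intro exI[of _ "m + d"]) auto
  qed (use m in auto)
  then obtain x where x: "u < x" "x < v" "gen_beta_map \<alpha> \<beta> x \<noteq> 0" by blast
  have "\<beta> * (x + \<gamma>) + \<alpha> = (\<beta> * x + \<alpha>) + 1" using beta_gamma by (simp add: algebra_simps)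
  then have "gen_beta_map \<alpha> \<beta> (x + \<gamma>) = gen_beta_map \<alpha> \<beta> x"
    unfolding gen_beta_map_def by (simp only: frac_1_eq)
  then have "robustly_match \<alpha> \<beta> x (x + \<gamma>)"
    unfolding robustly_match_def by (intro exI[of _ 1]) (use x in auto)
  then show False using g x by (auto simp: surviving_def)
qed

text \<open>
  The second alternative follows from the first: the reflection \<open>z \<mapsto> 1 - h - z\<close> of the lower
  points satisfies the same transport rules for the parameter \<open>1 + \<gamma>\<^sup>3 - \<alpha>\<close>, as \<open>\<beta> + \<gamma>\<^sup>3 = 2\<close>.
\<close>

lemma not_surviving:
  assumes a: "0 \<le> \<alpha>" "\<alpha> \<le> 1" "\<alpha> < \<gamma> \<or> 1 - \<gamma> + \<gamma>^3 < \<alpha>"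
    and h: "h \<in> gaps"
  shows "\<not> surviving \<alpha> h u v"
  using a(3)
proof
  assume "\<alpha> < \<gamma>"
  interpret survivors \<beta> \<gamma> \<alpha> "surviving \<alpha>"
    by unfold_locales
      (fact surviving_range surviving_plus surviving_minus not_surviving_gamma a(1) \<open>\<alpha> < \<gamma>\<close>)+
  show ?thesis using no_good[OF h] .
next
  assume a': "1 - \<gamma> + \<gamma>^3 < \<alpha>"
  have bg: "\<beta> + \<gamma>^3 = 2" using beta_eq gamma_cubic by simp
  interpret survivors \<beta> \<gamma> "1 + \<gamma>^3 - \<alpha>" "\<lambda>h u v. surviving \<alpha> h (1 - h - v) (1 - h - u)"
  proof
    fix h u v h' n p q
    show "0 \<le> u \<and> u < v \<and> v \<le> 1 - h" if "surviving \<alpha> h (1 - h - v) (1 - h - u)"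
      using surviving_range[OF that] by auto
    show "surviving \<alpha> h' (1 - h' - q) (1 - h' - p)"
      if g: "surviving \<alpha> h (1 - h - v) (1 - h - u)" and h: "\<beta> * h - h' \<in> \<int>" "n \<in> \<int>" "0 < h'"
        and pq: "\<beta> * u + (1 + \<gamma> ^ 3 - \<alpha>) \<le> n + p" "n + q \<le> \<beta> * v + (1 + \<gamma> ^ 3 - \<alpha>)"
          "0 \<le> p" "p < q" "q \<le> 1 - h'"
    proof (rule surviving_plus[OF g h(1), of "2 - n - (\<beta> * h - h')"])
      show "2 - n - (\<beta> * h - h') \<in> \<int>" using h by simp
    qed (use h pq bg in \<open>auto simp: algebra_simps\<close>)
    show "surviving \<alpha> h' (1 - h' - q) (1 - h' - p)"
      if g: "surviving \<alpha> h (1 - h - v) (1 - h - u)" and h: "\<beta> * h + h' \<in> \<int>" "n \<in> \<int>" "0 < h'"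
        and pq: "\<beta> * u + (1 + \<gamma> ^ 3 - \<alpha>) \<le> n + h' + p" "n + h' + q \<le> \<beta> * v + (1 + \<gamma> ^ 3 - \<alpha>)"
          "0 \<le> p" "p < q" "q \<le> 1 - h'"
    proof (rule surviving_minus[OF g h(1), of "2 - n - (\<beta> * h + h')"])
      show "2 - n - (\<beta> * h + h') \<in> \<int>" using h by simp
    qed (use h pq bg in \<open>auto simp: algebra_simps\<close>)
    show "\<not> surviving \<alpha> \<gamma> (1 - \<gamma> - v) (1 - \<gamma> - u)" by (rule not_surviving_gamma)
    show "0 \<le> 1 + \<gamma>^3 - \<alpha>" using a gamma_cube_bounds by simp
    show "1 + \<gamma>^3 - \<alpha> < \<gamma>" using a' by simp
  qed
  show ?thesis using no_good[OF h, of "1 - h - u" "1 - h - v"] by simp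
qed

text \<open>
  The distances of the two orbits are \<open>C\<close>, \<open>D\<close>, \<open>\<gamma>\<close> and then 0.
\<close>

lemma matching_middle:
  assumes "\<gamma> < \<alpha>" "\<alpha> < 1 - \<gamma> + \<gamma>^3"
  shows "has_matching \<alpha> \<beta>"
proof -
  let ?T = "gen_beta_map \<alpha> \<beta>"
  note b = gamma_bounds gamma_cube_bounds
  have b1: "\<beta> * \<alpha> > 1" "\<beta> * \<alpha> < \<beta> - 1 + \<gamma>^2"
    using mult_strict_left_mono[OF assms(1), of \<beta>] mult_strict_left_mono[OF assms(2), of \<beta>]
      beta_gt_1 beta_gamma beta_gamma_cube by (auto simp: algebra_simps)
  have b2: "\<beta>^2 * \<alpha> > \<beta>" "\<beta>^2 * \<alpha> < \<beta>^2 - \<beta> + \<gamma>"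
    using mult_strict_left_mono[OF b1(1), of \<beta>] mult_strict_left_mono[OF b1(2), of \<beta>]
      beta_gt_1 beta_times_gamma_sq
    unfolding distrib_left right_diff_distrib power2_eq_square[of \<beta>] by auto
  have x1: "?T 0 = \<alpha>" by (rule gen_beta_map_eqI) (use assms b in auto)
  have y1: "?T 1 = \<alpha> - \<gamma>^3"
  proof (rule gen_beta_map_eqI)
    have "\<beta> * 1 + \<alpha> - (\<alpha> - \<gamma>^3) = 2" using beta_eq gamma_cubic by simp
    then show "\<beta> * 1 + \<alpha> - (\<alpha> - \<gamma>^3) \<in> \<int>" by simp
  qed (use assms b in auto)
  have x2: "?T \<alpha> = \<beta> * \<alpha> + \<alpha> - 1"
    by (rule gen_beta_map_eqI) (use assms b b1 beta_bounds in auto)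
  have y2: "?T (\<alpha> - \<gamma>^3) = \<beta> * \<alpha> + \<alpha> - 1 - \<gamma>^2"
    by (rule gen_beta_map_eqI)
      (use assms b b1 beta_bounds beta_gamma_cube in \<open>auto simp: right_diff_distrib\<close>)
  define z where "z = \<beta>^2 * \<alpha> + \<beta> * \<alpha> + \<alpha> - \<beta> - \<gamma> - 1"
  have z: "0 < z" "z + \<gamma> < 1"
    using b1 b2 assms beta_sq gamma_cubic by (auto simp: z_def)
  have x3: "?T (\<beta> * \<alpha> + \<alpha> - 1) = z + \<gamma>"
    by (rule gen_beta_map_eqI) (use z gamma_pos in \<open>auto simp: z_def algebra_simps power2_eq_square\<close>)
  have y3: "?T (\<beta> * \<alpha> + \<alpha> - 1 - \<gamma>^2) = z"
  proof (rule gen_beta_map_eqI)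
    have "\<beta> * (\<beta> * \<alpha> + \<alpha> - 1 - \<gamma>^2) + \<alpha> - z = 1"
      using beta_times_gamma_sq by (simp add: z_def algebra_simps power2_eq_square)
    then show "\<beta> * (\<beta> * \<alpha> + \<alpha> - 1 - \<gamma>^2) + \<alpha> - z \<in> \<int>" by simp
  qed (use z gamma_pos in auto)
  have "\<beta> * (z + \<gamma>) + \<alpha> = (\<beta> * z + \<alpha>) + 1" using beta_gamma by (simp add: algebra_simps)
  then have "?T (z + \<gamma>) = ?T z" unfolding gen_beta_map_def by (simp only: frac_1_eq)
  moreover have "(?T ^^ 4) x = ?T (?T (?T (?T x)))" for x by (simp add: numeral_eq_Suc)
  ultimately have "(?T ^^ 4) 0 = (?T ^^ 4) 1"
    by (simp only: x1 y1 x2 y2 x3 y3)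
  then show ?thesis unfolding has_matching_def by (intro exI[of _ 4]) simp
qed

end

section \<open>Separation of integer combinations of powers of the base\<close>

context tribonacci
begin

text \<open>
  A complex conjugate of \<open>\<beta>\<close>, that is, a root of the cofactor \<open>X\<^sup>2 + (\<beta> - 1) * X + \<gamma>\<close> of \<open>X - \<beta>\<close> in
  \<open>X\<^sup>3 - X\<^sup>2 - X - 1\<close>.
\<close>

definition \<omega> :: complex where
  "\<omega> = Complex ((1 - \<beta>) / 2) (sqrt (\<gamma> - ((\<beta> - 1) / 2)^2))"

lemma omega_im_arg: "0 < \<gamma> - ((\<beta> - 1) / 2)^2"
proof -
  have "((\<beta> - 1) / 2)^2 < (42/100)^2"
    using beta_bounds by (intro power_strict_mono) auto
  then show ?thesis using gamma_bounds by (simp add: power2_eq_square)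
qed

lemma Re_omega: "Re \<omega> = (1 - \<beta>) / 2" and Im_omega_pos: "0 < Im \<omega>"
  using omega_im_arg by (simp_all add: \<omega>_def)

lemma Im_omega_sq: "(Im \<omega>)^2 = \<gamma> - ((1 - \<beta>) / 2)^2"
  using omega_im_arg by (simp add: \<omega>_def power2_eq_square field_simps)

lemma omega_sq: "\<omega>^2 = complex_of_real (1 - \<beta>) * \<omega> - complex_of_real \<gamma>"
proof (rule complex_eqI)
  show "Re (\<omega>^2) = Re (complex_of_real (1 - \<beta>) * \<omega> - complex_of_real \<gamma>)"
    using Im_omega_sq by (simp add: Re_omega power2_eq_square field_simps)
  show "Im (\<omega>^2) = Im (complex_of_real (1 - \<beta>) * \<omega> - complex_of_real \<gamma>)"
    by (simp add: Re_omega power2_eq_square field_simps)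
qed

lemma omega_cubic: "\<omega>^3 = \<omega>^2 + \<omega> + 1"
proof -
  have "\<gamma> = \<beta>^2 - \<beta> - 1" using beta_sq by simp
  then have g: "complex_of_real \<gamma> = complex_of_real \<beta> ^2 - complex_of_real \<beta> - 1" by simp
  have bg: "complex_of_real \<beta> * complex_of_real \<gamma> = 1"
    using beta_gamma by (metis of_real_1 of_real_mult)
  from omega_sq have "\<omega>^2 = (1 - complex_of_real \<beta>) * \<omega> - complex_of_real \<gamma>" by simp
  with g bg show ?thesis by algebra
qed

lemma cmod_omega_sq: "(cmod \<omega>)^2 = \<gamma>"
  using Im_omega_sq by (simp add: cmod_power2 Re_omega)

lemma cmod_omega_le: "cmod \<omega> \<le> 74/100"
proof (rule power2_le_imp_le)
  show "(cmod \<omega>)^2 \<le> (74/100)^2" unfolding cmod_omega_sq using gamma_upper by (simp add: power2_eq_square)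
qed simp

lemma beta_irrational: "\<beta> \<notin> \<rat>"
proof
  assume "\<beta> \<in> \<rat>"
  moreover have "algebraic_int \<beta>"
  proof (rule algebraic_int.intros)
    show "poly [:-1, -1, -1, 1:] \<beta> = 0"
      using beta_cubic by (simp add: power2_eq_square power3_eq_cube algebra_simps)
    show "\<forall>i. coeff [:-1, -1, -1, 1 :: real:] i \<in> \<int>"
      by (auto simp: coeff_pCons split: nat.splits)
  qed simp
  ultimately have "\<beta> \<in> \<int>" using rational_algebraic_int_is_int by blast
  then obtain k :: int where "\<beta> = of_int k" by (auto elim: Ints_cases)
  then have "1 < k" "k < 2" using beta_bounds by auto
  then show False by simp
qed

definition elt :: "int \<Rightarrow> int \<Rightarrow> int \<Rightarrow> real" where
  "elt a b c = of_int a + of_int b * \<beta> + of_int c * \<beta>^2"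

definition conj_elt :: "int \<Rightarrow> int \<Rightarrow> int \<Rightarrow> complex" where
  "conj_elt a b c = of_int a + of_int b * \<omega> + of_int c * \<omega>^2"

text \<open>
  Conjugation is injective.  Here this is seen directly: as \<open>\<omega>\<close> is not real, a vanishing conjugate
  would express \<open>\<beta>\<close> as a quotient of integers unless the coefficients vanish.
\<close>

lemma conj_elt_eq_0:
  assumes "conj_elt a b c = 0"
  shows "elt a b c = 0"
proof -
  have "conj_elt a b c = complex_of_real (a - c * \<gamma>) + complex_of_real (b + c * (1 - \<beta>)) * \<omega>"
    by (simp add: conj_elt_def omega_sq algebra_simps)
  then have "Im (complex_of_real (a - c * \<gamma>) + complex_of_real (b + c * (1 - \<beta>)) * \<omega>) = 0"
     and re: "Re (complex_of_real (a - c * \<gamma>) + complex_of_real (b + c * (1 - \<beta>)) * \<omega>) = 0"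
    using assms by simp_all
  then have b: "b + c * (1 - \<beta>) = 0" using Im_omega_pos by simp
  have "c = 0"
  proof (rule ccontr)
    assume "c \<noteq> 0"
    then have "\<beta> = of_int b / of_int c + 1" using b by (simp add: field_simps)
    then have "\<beta> \<in> \<rat>" by (metis Rats_1 Rats_add Rats_divide Rats_of_int)
    then show False using beta_irrational by simp
  qed
  then show ?thesis using b re by (simp add: elt_def)
qed

text \<open>
  The product of an element of \<open>\<int>[\<beta>]\<close> with its two complex conjugates is its norm; the right-hand
  side is the norm form in terms of the coefficients.
\<close>

lemma norm_integer:
  "elt a b c * (cmod (conj_elt a b c))^2 =
     of_int (a^3 + a^2*b + 3*a^2*c - a*b^2 - 4*a*b*c - a*c^2 + b^3 + b^2*c - b*c^2 + c^3)"
proof -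
  define a' b' c' where "a' = real_of_int a" and "b' = real_of_int b" and "c' = real_of_int c"
  have "Re (conj_elt a b c) = a' + b' * Re \<omega> + c' * ((Re \<omega>)^2 - (Im \<omega>)^2)"
    "Im (conj_elt a b c) = b' * Im \<omega> + c' * (2 * Re \<omega> * Im \<omega>)"
    by (simp_all add: conj_elt_def a'_def b'_def c'_def power2_eq_square)
  note RI = this
  have "(cmod (conj_elt a b c))^2 =
      (a' + b' * Re \<omega> + c' * ((Re \<omega>)^2 - (Im \<omega>)^2))^2 + (b' + c' * (2 * Re \<omega>))^2 * (Im \<omega>)^2"
    unfolding cmod_power2 RI by (simp add: power2_eq_square algebra_simps)
  also have "\<dots> = a'^2 + b'^2*\<gamma> + c'^2*\<gamma>^2 + a'*b'*(1-\<beta>) + a'*c'*((1-\<beta>)^2 - 2*\<gamma>) + b'*c'*\<gamma>*(1-\<beta>)"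
    unfolding Im_omega_sq Re_omega by (simp add: power2_eq_square field_simps)
  finally have 1: "(cmod (conj_elt a b c))^2 = \<dots>" .
  have g: "\<gamma> = \<beta>^2 - \<beta> - 1" using beta_sq by simp
  have "(a' + b' * \<beta> + c' * \<beta>^2) *
      (a'^2 + b'^2*\<gamma> + c'^2*\<gamma>^2 + a'*b'*(1-\<beta>) + a'*c'*((1-\<beta>)^2 - 2*\<gamma>) + b'*c'*\<gamma>*(1-\<beta>))
    = a'^3 + a'^2*b' + 3*a'^2*c' - a'*b'^2 - 4*a'*b'*c' - a'*c'^2 + b'^3 + b'^2*c' - b'*c'^2 + c'^3"
    using g beta_cubic by algebra
  then show ?thesis unfolding 1 by (simp add: elt_def a'_def b'_def c'_def)
qed

text \<open>
  The bound 12 is chosen such that the set is stable under \<open>v \<mapsto> \<beta> * v + e\<close> for integers \<open>\<bar>e\<bar> \<le> 3\<close>: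
  on conjugates this map multiplies by a factor of modulus at most \<open>0.74\<close> and \<open>0.74 * 12 + 3 \<le> 12\<close>.
\<close>

definition \<Lambda> :: "real set" where
  "\<Lambda> = {elt a b c | a b c. cmod (conj_elt a b c) \<le> 12}"

lemma Lambda_0: "0 \<in> \<Lambda>" and Lambda_minus_1: "-1 \<in> \<Lambda>"
proof -
  have "elt 0 0 0 = 0" "conj_elt 0 0 0 = 0" "elt (-1) 0 0 = -1" "conj_elt (-1) 0 0 = -1"
    by (simp_all add: elt_def conj_elt_def)
  then show "0 \<in> \<Lambda>" "-1 \<in> \<Lambda>" unfolding \<Lambda>_def
    by (smt (verit, best) mem_Collect_eq norm_zero norm_minus_cancel norm_one)+
qed

lemma Lambda_step:
  assumes "v \<in> \<Lambda>" "\<bar>e\<bar> \<le> 3"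
  shows "\<beta> * v + of_int e \<in> \<Lambda>"
proof -
  obtain a b c where v: "v = elt a b c" and n: "cmod (conj_elt a b c) \<le> 12"
    using assms(1) unfolding \<Lambda>_def by blast
  have "\<beta> * v + of_int e = elt (c + e) (a + c) (b + c)"
    unfolding v elt_def of_int_add using beta_cubic by algebra
  moreover have "conj_elt (c + e) (a + c) (b + c) = \<omega> * conj_elt a b c + of_int e"
    unfolding conj_elt_def of_int_add using omega_cubic by algebra
  moreover have "cmod (\<omega> * conj_elt a b c + of_int e) \<le> 74/100 * 12 + 3"
  proof (rule norm_triangle_le)
    have "cmod (\<omega> * conj_elt a b c) \<le> 74/100 * 12"
      unfolding norm_mult using cmod_omega_le n by (intro mult_mono) auto
    moreover have "cmod (of_int e) \<le> 3" using assms(2) by simp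
    ultimately show "cmod (\<omega> * conj_elt a b c) + cmod (of_int e) \<le> 74/100 * 12 + 3" by simp
  qed
  ultimately show ?thesis unfolding \<Lambda>_def by fastforce
qed

text \<open>
  The conjugate of \<open>v - w\<close> has modulus at most 24 and the norm of \<open>v - w\<close> is a nonzero integer, so
  \<open>24\<^sup>2 * \<bar>v - w\<bar> \<ge> 1\<close>.
\<close>

lemma Lambda_separated:
  assumes "v \<in> \<Lambda>" "w \<in> \<Lambda>" "v \<noteq> w"
  shows "1 \<le> 576 * \<bar>v - w\<bar>"
proof -
  obtain a b c a' b' c' where v: "v = elt a b c" "cmod (conj_elt a b c) \<le> 12"
    and w: "w = elt a' b' c'" "cmod (conj_elt a' b' c') \<le> 12"
    using assms unfolding \<Lambda>_def by blast
  let ?d = "elt (a - a') (b - b') (c - c')" and ?e = "conj_elt (a - a') (b - b') (c - c')"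
  have d: "v - w = ?d" by (simp add: v w elt_def algebra_simps)
  have e: "?e = conj_elt a b c - conj_elt a' b' c'" by (simp add: conj_elt_def algebra_simps)
  have "cmod ?e \<le> 24" unfolding e using norm_triangle_ineq4[of "conj_elt a b c" "conj_elt a' b' c'"] v w by simp
  then have e24: "(cmod ?e)^2 \<le> 24^2" by (intro power_mono) auto
  have d0: "?d \<noteq> 0" using d assms(3) by simp
  then have "?e \<noteq> 0" using conj_elt_eq_0 by blast
  with d0 have nz: "?d * (cmod ?e)^2 \<noteq> 0" by simp
  have "?d * (cmod ?e)^2 \<in> \<int>" unfolding norm_integer by (rule Ints_of_int)
  with nz have "1 \<le> \<bar>?d * (cmod ?e)^2\<bar>" using Ints_nonzero_abs_ge1 by blast
  also have "\<dots> = \<bar>?d\<bar> * (cmod ?e)^2" by (simp add: abs_mult)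
  also have "\<dots> \<le> \<bar>?d\<bar> * 24^2" using e24 by (rule mult_left_mono) simp
  finally show ?thesis unfolding d by simp
qed

lemma card_Lambda_le:
  assumes "0 \<le> R"
  shows "finite (\<Lambda> \<inter> {0..R})" "real (card (\<Lambda> \<inter> {0..R})) \<le> 577 * R + 1"
proof -
  \<comment> \<open>Numbers with the same integer part of \<open>577 * v\<close> are less than \<open>1 / 576\<close> apart.\<close>
  define f where "f v = \<lfloor>577 * v\<rfloor>" for v :: real
  have inj: "inj_on f (\<Lambda> \<inter> {0..R})"
  proof (rule inj_onI, rule ccontr)
    fix v w assume "v \<in> \<Lambda> \<inter> {0..R}" "w \<in> \<Lambda> \<inter> {0..R}" "f v = f w" "v \<noteq> w"
    then have "1 \<le> 576 * \<bar>v - w\<bar>" "\<bar>577 * v - 577 * w\<bar> < 1"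
      using Lambda_separated by (auto simp: f_def, linarith)
    moreover have "\<bar>577 * v - 577 * w\<bar> = 577 * \<bar>v - w\<bar>" by (simp add: abs_if)
    ultimately show False by linarith
  qed
  have sub: "f ` (\<Lambda> \<inter> {0..R}) \<subseteq> {0..\<lfloor>577 * R\<rfloor>}" by (auto simp: f_def floor_mono)
  show "finite (\<Lambda> \<inter> {0..R})" using inj sub finite_imageD finite_subset by blast
  have "card (\<Lambda> \<inter> {0..R}) \<le> card {0..\<lfloor>577 * R\<rfloor>}"
    using card_inj_on_le[OF inj sub] by simp
  also have "\<dots> = nat (\<lfloor>577 * R\<rfloor> + 1)" by simp
  finally have "real (card (\<Lambda> \<inter> {0..R})) \<le> real (nat (\<lfloor>577 * R\<rfloor> + 1))" by simp
  also have "\<dots> \<le> 577 * R + 1" using assms by simp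
  finally show "real (card (\<Lambda> \<inter> {0..R})) \<le> 577 * R + 1" .
qed

end

section \<open>Almost every parameter is infinitely often far from all discontinuities\<close>

text \<open>
  The slope, between discontinuities, of the \<open>n\<close>-th iterate of a constant initial point as a function
  of the parameter.
\<close>

primrec slope :: "real \<Rightarrow> nat \<Rightarrow> real" where
  "slope \<beta> 0 = 0"
| "slope \<beta> (Suc n) = \<beta> * slope \<beta> n + 1"

text \<open>
  The sum of the integer parts removed along the orbit, weighted by powers of \<open>\<beta>\<close>, minus \<open>\<beta>\<^sup>n * x\<close>.  As a
  function of \<open>\<alpha>\<close> it is constant between discontinuities.
\<close>

definition lift :: "real \<Rightarrow> real \<Rightarrow> real \<Rightarrow> nat \<Rightarrow> real" where
  "lift \<beta> x \<alpha> n = slope \<beta> n * \<alpha> - (gen_beta_map \<alpha> \<beta> ^^ n) x"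

lemma lift_0: "lift \<beta> x \<alpha> 0 = - x"
  by (simp add: lift_def)

lemma lift_Suc:
  "lift \<beta> x \<alpha> (Suc n) = \<beta> * lift \<beta> x \<alpha> n + of_int \<lfloor>\<beta> * (gen_beta_map \<alpha> \<beta> ^^ n) x + \<alpha>\<rfloor>"
  by (simp add: lift_def gen_beta_map_def frac_def algebra_simps)

lemma orbit_range: "x \<in> {0..1} \<Longrightarrow> (gen_beta_map \<alpha> \<beta> ^^ n) x \<in> {0..1}"
  by (cases n) (auto simp: gen_beta_map_def frac_lt_1 less_imp_le)

context tribonacci
begin

lemma slope_ge: "real n \<le> slope \<beta> n"
proof (induction n)
  case (Suc n)
  then have "1 * slope \<beta> n \<le> \<beta> * slope \<beta> n" using beta_gt_1 by (intro mult_right_mono) auto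
  with Suc show ?case by simp
qed simp

lemma slope_pos: "0 < n \<Longrightarrow> 0 < slope \<beta> n"
  using slope_ge[of n] by simp

lemma slope_sum: "(\<Sum>k=1..n. slope \<beta> k) \<le> 3 * slope \<beta> n"
proof (induction n)
  case (Suc n)
  have "0 \<le> slope \<beta> n" using slope_ge[of n] by simp
  then have "3/2 * slope \<beta> n \<le> \<beta> * slope \<beta> n" using beta_bounds by (intro mult_right_mono) auto
  with Suc show ?case by simp
qed simp

lemma lift_in_Lambda:
  assumes "x \<in> {0, 1}" "\<alpha> \<in> {0..1}"
  shows "lift \<beta> x \<alpha> n \<in> \<Lambda>"
proof (induction n)
  case 0
  then show ?case using assms Lambda_0 Lambda_minus_1 by (auto simp: lift_0)
next
  case (Suc n)
  define y where "y = (gen_beta_map \<alpha> \<beta> ^^ n) x"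
  have "y \<in> {0..1}" unfolding y_def using assms by (intro orbit_range) auto
  then have "0 \<le> \<beta> * y" "\<beta> * y \<le> 2 * 1"
    using beta_bounds by (auto intro!: mult_mono[of \<beta> 2 y 1, simplified])
  then have "\<bar>\<lfloor>\<beta> * y + \<alpha>\<rfloor>\<bar> \<le> 3" using assms by (auto simp: abs_if; linarith)
  then show ?case unfolding lift_Suc y_def by (intro Lambda_step Suc)
qed

text \<open>
  A parameter at which the \<open>k\<close>-th iterate of 0 or 1 is 0 satisfies \<open>slope \<beta> k * \<alpha> = v\<close> with \<open>v\<close> the value of
  \<open>lift\<close>, which lies in \<open>\<Lambda>\<close>.  Taking all such quotients instead of those that occur keeps the
  cardinality of the right order.
\<close>

definition discontinuities :: "nat \<Rightarrow> real set" where
  "discontinuities n = (\<Union>k\<in>{1..n}. (\<lambda>v. v / slope \<beta> k) ` (\<Lambda> \<inter> {0..slope \<beta> k}))"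

text \<open>
  While the lift at time \<open>k\<close> is constant, the next integer part is the floor of an increasing affine function
  of the parameter.  If it changed within the interval, that function would be an integer somewhere,
  so the next iterate would be 0 there, at one of the excluded parameters.
\<close>

lemma lift_constant:
  assumes x: "x \<in> {0, 1}" and I: "is_interval I" "I \<subseteq> {0..1}" "I \<inter> discontinuities n = {}"
    and a: "\<alpha> \<in> I" "\<alpha>' \<in> I" and "k \<le> n"
  shows "lift \<beta> x \<alpha> k = lift \<beta> x \<alpha>' k"
  using \<open>k \<le> n\<close> a
proof (induction k arbitrary: \<alpha> \<alpha>')
  case 0
  then show ?case by (simp add: lift_0)
next
  case (Suc k)
  define X where "X = lift \<beta> x \<alpha> k"
  have X: "lift \<beta> x t k = X" if "t \<in> I" for t
    unfolding X_def by (rule Suc.IH) (use Suc.prems that in auto)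
  have eq: "\<beta> * (gen_beta_map t \<beta> ^^ k) x + t = slope \<beta> (Suc k) * t - \<beta> * X" if "t \<in> I" for t
    using X[OF that] by (simp add: lift_def algebra_simps)
  have le: "\<lfloor>slope \<beta> (Suc k) * t' - \<beta> * X\<rfloor> \<le> \<lfloor>slope \<beta> (Suc k) * t - \<beta> * X\<rfloor>"
    if t: "t \<in> I" "t' \<in> I" "t < t'" for t t'
  proof (rule ccontr)
    define m where "m = \<lfloor>slope \<beta> (Suc k) * t' - \<beta> * X\<rfloor>"
    assume "\<not> ?thesis"
    then have m: "slope \<beta> (Suc k) * t - \<beta> * X < of_int m" "of_int m \<le> slope \<beta> (Suc k) * t' - \<beta> * X"
      unfolding m_def by linarith+
    define u where "u = (\<beta> * X + of_int m) / slope \<beta> (Suc k)"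
    have s: "0 < slope \<beta> (Suc k)" by (rule slope_pos) simp
    have u: "slope \<beta> (Suc k) * u = \<beta> * X + of_int m" using s by (simp add: u_def)
    have "slope \<beta> (Suc k) * t < slope \<beta> (Suc k) * u" "slope \<beta> (Suc k) * u \<le> slope \<beta> (Suc k) * t'"
      using u m by linarith+
    then have "t < u" "u \<le> t'" using s by (simp_all only: mult_less_cancel_left_pos mult_le_cancel_left_pos)
    then have uI: "u \<in> I" using I(1)[unfolded is_interval_1] t(1,2) less_imp_le by blast
    have "lift \<beta> x u (Suc k) = \<beta> * X + of_int m"
      unfolding lift_Suc eq[OF uI] X[OF uI] u by simp
    then have "\<beta> * X + of_int m \<in> \<Lambda>" using lift_in_Lambda[OF x, of u "Suc k"] uI I(2) by auto
    moreover have "\<beta> * X + of_int m \<in> {0..slope \<beta> (Suc k)}"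
      unfolding u[symmetric] using uI I(2) s by (auto intro!: mult_left_le)
    ultimately have "u \<in> discontinuities n"
      unfolding discontinuities_def u_def using Suc.prems by (intro UN_I[of "Suc k"]) auto
    then show False using uI I(3) by blast
  qed
  have mono: "\<lfloor>slope \<beta> (Suc k) * t - \<beta> * X\<rfloor> \<le> \<lfloor>slope \<beta> (Suc k) * t' - \<beta> * X\<rfloor>"
    if "t \<le> t'" for t t'
    using that slope_pos[of "Suc k"] by (intro floor_mono diff_right_mono mult_left_mono) auto
  have "\<lfloor>slope \<beta> (Suc k) * \<alpha> - \<beta> * X\<rfloor> = \<lfloor>slope \<beta> (Suc k) * \<alpha>' - \<beta> * X\<rfloor>"
    using le[OF Suc.prems(2,3)] le[OF Suc.prems(3,2)] mono[of \<alpha> \<alpha>'] mono[of \<alpha>' \<alpha>]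
    by (cases \<alpha> \<alpha>' rule: linorder_cases) auto
  then show ?case
    unfolding lift_Suc eq[OF Suc.prems(2)] eq[OF Suc.prems(3)] X[OF Suc.prems(2)] X[OF Suc.prems(3)] by simp
qed

definition crowded :: "real \<Rightarrow> nat \<Rightarrow> real set" where
  "crowded \<eta> n = (\<Union>t\<in>discontinuities n. {t - \<eta> / slope \<beta> n<..<t + \<eta> / slope \<beta> n})"

lemma finite_discontinuities: "finite (discontinuities n)"
  unfolding discontinuities_def
proof (intro finite_UN_I finite_imageI card_Lambda_le(1))
  show "0 \<le> slope \<beta> k" for k using slope_ge[of k] by simp
qed simp

lemma card_discontinuities: "real (card (discontinuities n)) \<le> 1734 * slope \<beta> n"
proof -
  have "real (card (discontinuities n)) \<le> (\<Sum>k=1..n. real (card ((\<lambda>v. v / slope \<beta> k) ` (\<Lambda> \<inter> {0..slope \<beta> k}))))"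
    unfolding discontinuities_def of_nat_sum[symmetric] of_nat_le_iff
    by (rule card_UN_le) simp
  also have "\<dots> \<le> (\<Sum>k=1..n. 578 * slope \<beta> k)"
  proof (rule sum_mono)
    fix k assume "k \<in> {1..n}"
    then have s: "1 \<le> slope \<beta> k" using slope_ge[of k] by simp
    have "card ((\<lambda>v. v / slope \<beta> k) ` (\<Lambda> \<inter> {0..slope \<beta> k})) \<le> card (\<Lambda> \<inter> {0..slope \<beta> k})"
      using card_Lambda_le(1)[of "slope \<beta> k"] s by (intro card_image_le) simp
    then show "real (card ((\<lambda>v. v / slope \<beta> k) ` (\<Lambda> \<inter> {0..slope \<beta> k}))) \<le> 578 * slope \<beta> k"
      using card_Lambda_le(2)[of "slope \<beta> k"] s by linarith
  qed
  also have "\<dots> = 578 * (\<Sum>k=1..n. slope \<beta> k)" by (rule sum_distrib_left[symmetric])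
  also have "\<dots> \<le> 1734 * slope \<beta> n" using slope_sum[of n] by simp
  finally show ?thesis .
qed

lemma crowded_measure:
  assumes "0 < \<eta>" "0 < n"
  shows "crowded \<eta> n \<in> sets lebesgue" "emeasure lebesgue (crowded \<eta> n) \<le> ennreal (3468 * \<eta>)"
proof -
  show "crowded \<eta> n \<in> sets lebesgue"
    unfolding crowded_def using finite_discontinuities by (intro sets.finite_UN) auto
  have s: "0 < slope \<beta> n" using assms slope_pos by simp
  have "emeasure lebesgue (crowded \<eta> n) \<le> (\<Sum>t\<in>discontinuities n. emeasure lebesgue {t - \<eta> / slope \<beta> n<..<t + \<eta> / slope \<beta> n})"
    unfolding crowded_def by (rule emeasure_subadditive_finite[OF finite_discontinuities]) auto
  also have "\<dots> = (\<Sum>t\<in>discontinuities n. ennreal (2 * \<eta> / slope \<beta> n))"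
    using assms s by (intro sum.cong) auto
  also have "\<dots> = of_nat (card (discontinuities n)) * ennreal (2 * \<eta> / slope \<beta> n)"
    by simp
  also have "\<dots> = ennreal (real (card (discontinuities n)) * (2 * \<eta> / slope \<beta> n))"
    unfolding ennreal_of_nat_eq_real_of_nat by (rule ennreal_mult'[symmetric]) simp
  also have "\<dots> \<le> ennreal (3468 * \<eta>)"
  proof (rule ennreal_leI)
    have "real (card (discontinuities n)) * (2 * \<eta> / slope \<beta> n) \<le> 1734 * slope \<beta> n * (2 * \<eta> / slope \<beta> n)"
      using card_discontinuities assms s by (intro mult_right_mono) auto
    then show "real (card (discontinuities n)) * (2 * \<eta> / slope \<beta> n) \<le> 3468 * \<eta>" using s by simp
  qed
  finally show "emeasure lebesgue (crowded \<eta> n) \<le> ennreal (3468 * \<eta>)" .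
qed

text \<open>
  The parameters that are eventually always in \<open>crowded \<eta> n\<close> form an increasing union of sets of measure
  \<open>O(\<eta>)\<close>, and \<open>\<eta>\<close> is arbitrary.
\<close>

lemma almost_all_uncrowded:
  "negligible {\<alpha>. \<forall>\<eta>>0. \<exists>N. \<forall>n\<ge>N. \<alpha> \<in> crowded \<eta> n}"
proof -
  let ?B = "{\<alpha>. \<forall>\<eta>>0. \<exists>N. \<forall>n\<ge>N. \<alpha> \<in> crowded \<eta> n}"
  have "\<exists>T. ?B \<subseteq> T \<and> T \<in> lmeasurable \<and> measure lebesgue T \<le> e" if "e > 0" for e
  proof -
    define \<eta> where "\<eta> = e / 3468"
    have eta: "\<eta> > 0" using that by (simp add: \<eta>_def)
    define T where "T N = (\<Inter>n\<in>{Suc N..}. crowded \<eta> n)" for N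
    have Tm: "T N \<in> sets lebesgue" for N
      unfolding T_def using crowded_measure(1)[OF eta] by (intro sets.countable_INT) auto
    have "emeasure lebesgue (T N) \<le> ennreal e" for N
    proof -
      have "emeasure lebesgue (T N) \<le> emeasure lebesgue (crowded \<eta> (Suc N))"
        using crowded_measure(1)[OF eta] by (intro emeasure_mono) (auto simp: T_def)
      also have "\<dots> \<le> ennreal (3468 * \<eta>)" using crowded_measure(2)[OF eta] by simp
      finally show ?thesis by (simp add: \<eta>_def)
    qed
    moreover have "incseq T" by (intro monoI) (auto simp: T_def)
    ultimately have "emeasure lebesgue (\<Union>N. T N) \<le> ennreal e"
      using Tm by (subst SUP_emeasure_incseq[symmetric]) (auto intro!: SUP_least)
    moreover have "(\<Union>N. T N) \<in> sets lebesgue" using Tm by auto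
    ultimately have "(\<Union>N. T N) \<in> lmeasurable" "measure lebesgue (\<Union>N. T N) \<le> e"
      using that by (auto simp: fmeasurable_def measure_def enn2real_leI intro: le_less_trans)
    moreover have "?B \<subseteq> (\<Union>N. T N)"
    proof
      fix \<alpha> assume "\<alpha> \<in> ?B"
      then obtain N where "\<forall>n\<ge>N. \<alpha> \<in> crowded \<eta> n" using eta by blast
      then have "\<alpha> \<in> T N" by (auto simp: T_def)
      then show "\<alpha> \<in> (\<Union>N. T N)" by blast
    qed
    ultimately show ?thesis by blast
  qed
  then show ?thesis unfolding negligible_outer_le by blast
qed

end

section \<open>Porous sets of reals are negligible\<close>

lemma emeasure_lebesgue_ball_real: "0 \<le> r \<Longrightarrow> emeasure lebesgue (ball (x::real) r) = ennreal (2 * r)"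
  by (simp add: ball_eq_greaterThanLessThan)

text \<open>
  By Vitali's theorem almost all of \<open>S\<close> is covered by disjoint balls inside \<open>T\<close>, each with a hole of relative
  size \<open>c\<close> that misses \<open>S\<close>.  Removing the holes leaves a cover of at most \<open>1 - c\<close> times the
  measure, which is then enlarged to an open set.
\<close>

lemma porous_measure_decrease:
  fixes S T :: "real set"
  assumes c: "0 < c" "c \<le> 1" and T: "open T" "T \<in> lmeasurable" "S \<subseteq> T"
    and porous: "\<And>x \<delta>. \<lbrakk>x \<in> S; 0 < \<delta>\<rbrakk> \<Longrightarrow>
      \<exists>r p. 0 < r \<and> r < \<delta> \<and> ball p (c * r) \<subseteq> ball x r \<and> ball p (c * r) \<inter> S = {}"
    and e: "0 < e"
  shows "\<exists>W. open W \<and> W \<in> lmeasurable \<and> S \<subseteq> W \<and> measure lebesgue W < (1 - c) * measure lebesgue T + e"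
proof -
  define K where "K = {(x, r, p). x \<in> S \<and> 0 < r \<and> ball x r \<subseteq> T \<and> ball p (c * r) \<subseteq> ball x r \<and> ball p (c * r) \<inter> S = {}}"
  define bl where "bl = (\<lambda>(x::real, r, p::real). ball x r)"
  define gap where "gap = (\<lambda>(x::real, r, p::real). ball p (c * r))"
  have "\<exists>i. i \<in> K \<and> x \<in> ball (fst i) (fst (snd i)) \<and> fst (snd i) < d" if x: "x \<in> S" and d: "0 < d" for x d
  proof -
    obtain \<rho> where \<rho>: "0 < \<rho>" "ball x \<rho> \<subseteq> T" using T x by (meson openE subsetD)
    obtain r p where rp: "0 < r" "r < min d \<rho>" "ball p (c * r) \<subseteq> ball x r" "ball p (c * r) \<inter> S = {}"
      using porous[OF x, of "min d \<rho>"] d \<rho> by auto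
    have "r \<le> \<rho>" using rp(2) by simp
    then have xT: "ball x r \<subseteq> T" by (rule order_trans[OF subset_ball \<rho>(2)])
    have "(x, r, p) \<in> K" unfolding K_def mem_Collect_eq prod.case
      by (intro conjI) (fact x rp xT)+
    moreover have "x \<in> ball x r" "r < d" using rp(1,2) by auto
    ultimately have "(x, r, p) \<in> K \<and> x \<in> ball (fst (x, r, p)) (fst (snd (x, r, p))) \<and> fst (snd (x, r, p)) < d"
      by (simp only: fst_conv snd_conv)
    then show ?thesis by blast
  qed
  from Vitali_covering_theorem_balls[of S K fst "\<lambda>i. fst (snd i)", OF this]
  obtain C where C: "countable C" "C \<subseteq> K"
    and disj: "pairwise (\<lambda>i j. disjnt (ball (fst i) (fst (snd i))) (ball (fst j) (fst (snd j)))) C"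
    and neg: "negligible (S - (\<Union>i\<in>C. ball (fst i) (fst (snd i))))" by blast
  have bl: "bl = (\<lambda>i. ball (fst i) (fst (snd i)))" by (auto simp: bl_def)
  define U where "U = (\<Union>i\<in>C. bl i)"
  define G where "G = (\<Union>i\<in>C. gap i)"
  have gb: "gap i \<subseteq> bl i" "bl i \<subseteq> T" "gap i \<inter> S = {}" "0 < fst (snd i)" if "i \<in> C" for i
    using subsetD[OF C(2) that] unfolding K_def bl_def gap_def
    by (cases i; simp only: mem_Collect_eq prod.case fst_conv snd_conv)+
  have sets: "bl i \<in> sets lebesgue" "gap i \<in> sets lebesgue" for i
    by (auto simp: bl_def gap_def split: prod.splits)
  have dbl: "disjoint_family_on bl C"
    using disj by (auto simp: disjoint_family_on_def pairwise_def disjnt_def bl)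
  then have dgap: "disjoint_family_on gap C"
    using gb(1) unfolding disjoint_family_on_def by blast
  have "emeasure lebesgue G = (\<integral>\<^sup>+i. emeasure lebesgue (gap i) \<partial>count_space C)"
    unfolding G_def by (rule emeasure_UN_countable) (use sets C dgap in auto)
  also have "\<dots> = (\<integral>\<^sup>+i. ennreal c * emeasure lebesgue (bl i) \<partial>count_space C)"
  proof (rule nn_integral_cong)
    fix i assume "i \<in> space (count_space C)"
    then have "0 < fst (snd i)" using gb(4) by simp
    moreover obtain x r p where i: "i = (x, r, p)" by (cases i)
    ultimately have r: "0 \<le> r" by simp
    have "ennreal (2 * (c * r)) = ennreal c * ennreal (2 * r)"
      using c r by (simp add: ennreal_mult[symmetric] mult_ac)
    then show "emeasure lebesgue (gap i) = ennreal c * emeasure lebesgue (bl i)"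
      unfolding i gap_def bl_def prod.case
      using emeasure_lebesgue_ball_real[OF r, of x] emeasure_lebesgue_ball_real[of "c * r" p] c r by simp
  qed
  also have "\<dots> = ennreal c * (\<integral>\<^sup>+i. emeasure lebesgue (bl i) \<partial>count_space C)"
    by (rule nn_integral_cmult) simp
  also have "(\<integral>\<^sup>+i. emeasure lebesgue (bl i) \<partial>count_space C) = emeasure lebesgue U"
    unfolding U_def by (rule emeasure_UN_countable[symmetric]) (use sets C dbl in auto)
  finally have GU: "emeasure lebesgue G = ennreal c * emeasure lebesgue U" .
  have UT: "U \<subseteq> T" unfolding U_def using gb(2) by blast
  have GU': "G \<subseteq> U" unfolding U_def G_def using gb(1) by blast
  have Us: "U \<in> sets lebesgue" unfolding U_def using sets(1) C(1) by (intro sets.countable_UN') auto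
  have Um: "U \<in> lmeasurable" by (rule fmeasurableI2[OF T(2) UT Us])
  have Gs: "G \<in> sets lebesgue" unfolding G_def using sets(2) C(1) by (intro sets.countable_UN') auto
  have mG: "measure lebesgue G = c * measure lebesgue U"
    unfolding measure_def GU using c by (simp add: enn2real_mult)
  define V where "V = (U - G) \<union> (S - U)"
  have negSU: "negligible (S - U)" using neg unfolding U_def bl .
  have VS: "S \<subseteq> V" unfolding V_def G_def using gb(3) by blast
  have UGm: "U - G \<in> lmeasurable" by (rule fmeasurable_Diff[OF Um Gs])
  have SUm: "S - U \<in> lmeasurable" by (rule negligible_imp_measurable[OF negSU])
  have Vm: "V \<in> lmeasurable" unfolding V_def by (rule fmeasurable.Un[OF UGm SUm])
  have "measure lebesgue V \<le> measure lebesgue (U - G) + measure lebesgue (S - U)"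
    unfolding V_def by (rule measure_Un_le) (rule fmeasurableD[OF UGm] fmeasurableD[OF SUm])+
  also have "\<dots> = (1 - c) * measure lebesgue U"
    unfolding measurable_measure_Diff[OF Um Gs GU'] mG negligible_imp_measure0[OF negSU]
    by (simp only: left_diff_distrib mult_1 add_0_right)
  also have "\<dots> \<le> (1 - c) * measure lebesgue T"
    by (rule mult_left_mono[OF measure_mono_fmeasurable[OF UT Us T(2)]]) (use c in simp)
  finally have mV: "measure lebesgue V \<le> (1 - c) * measure lebesgue T" .
  obtain W where W: "open W" "V \<subseteq> W" "W - V \<in> lmeasurable" "emeasure lebesgue (W - V) < ennreal e"
    using sets_lebesgue_outer_open[OF fmeasurableD[OF Vm] e] by blast
  have "W = V \<union> (W - V)" using W by blast
  then have Wm: "W \<in> lmeasurable" using Vm W(3) by (metis fmeasurable.Un)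
  have "measure lebesgue (W - V) < e"
    using W(3,4) e by (metis emeasure_eq_measure2 ennreal_less_iff measure_nonneg)
  moreover have "measure lebesgue (W - V) = measure lebesgue W - measure lebesgue V"
    by (rule measurable_measure_Diff[OF Wm fmeasurableD[OF Vm] W(2)])
  ultimately have "measure lebesgue W < (1 - c) * measure lebesgue T + e" using mV by linarith
  then show ?thesis using W(1,2) VS Wm by blast
qed

text \<open>
  The infimum of the measures of open sets containing \<open>S\<close> satisfies \<open>\<mu> \<le> (1 - c) * \<mu>\<close>.
  Open covers are used because \<open>S\<close> may fail to be measurable.
\<close>

lemma negligible_porous_uniform:
  fixes S :: "real set"
  assumes c: "0 < c" "c \<le> 1" and S: "bounded S"
    and porous: "\<And>x \<delta>. \<lbrakk>x \<in> S; 0 < \<delta>\<rbrakk> \<Longrightarrow>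
      \<exists>r p. 0 < r \<and> r < \<delta> \<and> ball p (c * r) \<subseteq> ball x r \<and> ball p (c * r) \<inter> S = {}"
  shows "negligible S"
proof -
  define M where "M = {measure lebesgue T | T. open T \<and> T \<in> lmeasurable \<and> S \<subseteq> T}"
  define \<mu> where "\<mu> = Inf M"
  obtain R where "S \<subseteq> ball 0 R" using S bounded_subset_ballD[of S 0] by blast
  then have M0: "M \<noteq> {}" unfolding M_def by (auto intro!: exI[of _ "ball 0 R"])
  have bdd: "bdd_below M" by (rule bdd_belowI[of _ 0]) (auto simp: M_def)
  have mu0: "0 \<le> \<mu>" unfolding \<mu>_def by (rule cInf_greatest[OF M0]) (auto simp: M_def)
  have "\<mu> \<le> 0"
  proof (rule ccontr)
    assume "\<not> \<mu> \<le> 0"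
    define e where "e = c * \<mu> / 2"
    have e: "0 < e" using c \<open>\<not> \<mu> \<le> 0\<close> by (simp add: e_def)
    then obtain m where "m \<in> M" "m < \<mu> + e"
      using cInf_lessD[OF M0, of "\<mu> + e"] unfolding \<mu>_def by auto
    then obtain T where T: "open T" "T \<in> lmeasurable" "S \<subseteq> T" "measure lebesgue T < \<mu> + e"
      unfolding M_def by auto
    obtain W where W: "open W" "W \<in> lmeasurable" "S \<subseteq> W" "measure lebesgue W < (1 - c) * measure lebesgue T + e"
      using porous_measure_decrease[OF c T(1-3) porous e] by blast
    have "\<mu> \<le> measure lebesgue W" unfolding \<mu>_def by (rule cInf_lower[OF _ bdd]) (use W in \<open>unfold M_def, blast\<close>)
    also have "\<dots> < (1 - c) * (\<mu> + e) + e"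
      using W(4) T(4) c mult_left_mono[of "measure lebesgue T" "\<mu> + e" "1 - c"] by linarith
    also have "\<dots> \<le> \<mu>"
    proof -
      have "(1 - c) * (\<mu> + e) + e = \<mu> - c * e"
        by (simp add: e_def field_simps)
      then show ?thesis using c e by simp
    qed
    finally show False by simp
  qed
  show ?thesis unfolding negligible_outer
  proof (intro allI impI)
    fix e :: real assume "0 < e"
    then obtain m where "m \<in> M" "m < e"
      using cInf_lessD[OF M0, of e] \<open>\<mu> \<le> 0\<close> unfolding \<mu>_def by auto
    then show "\<exists>T. S \<subseteq> T \<and> T \<in> lmeasurable \<and> measure lebesgue T < e"
      unfolding M_def by blast
  qed
qed

text \<open>
  Reduction to the uniform case by splitting \<open>S\<close> into countably many pieces.
\<close>

lemma negligible_porous: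
  fixes S :: "real set"
  assumes porous: "\<And>x. x \<in> S \<Longrightarrow> \<exists>c>0. \<forall>\<delta>>0.
      \<exists>r p. 0 < r \<and> r < \<delta> \<and> ball p (c * r) \<subseteq> ball x r \<and> ball p (c * r) \<inter> S = {}"
  shows "negligible S"
proof -
  define P where "P c x \<longleftrightarrow> (\<forall>\<delta>>0. \<exists>r p. 0 < r \<and> r < \<delta> \<and> ball p (c * r) \<subseteq> ball x r \<and> ball p (c * r) \<inter> S = {})"
    for c x :: real
  define A where "A n = {x \<in> S. P (1 / real (Suc n)) x \<and> \<bar>x\<bar> \<le> real n}" for n
  have "negligible (A n)" for n
  proof (rule negligible_porous_uniform)
    show "bounded (A n)" by (rule boundedI[of _ "real n"]) (auto simp: A_def)
    fix x \<delta> :: real assume "x \<in> A n" "0 < \<delta>"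
    then obtain r p where "0 < r" "r < \<delta>" "ball p (1 / real (Suc n) * r) \<subseteq> ball x r" "ball p (1 / real (Suc n) * r) \<inter> S = {}"
      unfolding A_def P_def by blast
    then show "\<exists>r p. 0 < r \<and> r < \<delta> \<and> ball p (1 / real (Suc n) * r) \<subseteq> ball x r \<and> ball p (1 / real (Suc n) * r) \<inter> A n = {}"
      by (intro exI[of _ r] exI[of _ p]) (auto simp: A_def)
  qed auto
  then have "negligible (\<Union>n. A n)" by (rule negligible_Union_nat)
  moreover have "S \<subseteq> (\<Union>n. A n)"
  proof
    fix x assume x: "x \<in> S"
    then obtain c where c: "c > 0" "P c x" using porous unfolding P_def by blast
    obtain n where n: "max (1 / c) \<bar>x\<bar> \<le> real n" using real_arch_simple by blast
    have "1 / c \<le> real (Suc n)" using n by simp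
    then have le: "1 / real (Suc n) \<le> c" using c by (simp add: field_simps)
    have "P (1 / real (Suc n)) x"
      unfolding P_def
    proof (intro allI impI)
      fix \<delta> :: real assume "0 < \<delta>"
      then obtain r p where rp: "0 < r" "r < \<delta>" "ball p (c * r) \<subseteq> ball x r" "ball p (c * r) \<inter> S = {}"
        using c(2) unfolding P_def by blast
      have "1 / real (Suc n) * r \<le> c * r" using le rp(1) by (intro mult_right_mono) auto
      then have "ball p (1 / real (Suc n) * r) \<subseteq> ball p (c * r)" by (rule subset_ball)
      then show "\<exists>r p. 0 < r \<and> r < \<delta> \<and> ball p (1 / real (Suc n) * r) \<subseteq> ball x r \<and> ball p (1 / real (Suc n) * r) \<inter> S = {}"
        using rp by (intro exI[of _ r] exI[of _ p]) blast
    qed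
    then show "x \<in> (\<Union>n. A n)" using x n by (auto simp: A_def)
  qed
  ultimately show ?thesis by (rule negligible_subset)
qed

section \<open>The set of parameters without matching is porous\<close>

lemma has_matchingI:
  assumes "(gen_beta_map \<alpha> \<beta> ^^ n) 0 = (gen_beta_map \<alpha> \<beta> ^^ n) 1"
  shows "has_matching \<alpha> \<beta>"
proof -
  have "(gen_beta_map \<alpha> \<beta> ^^ Suc n) 0 = (gen_beta_map \<alpha> \<beta> ^^ Suc n) 1"
    unfolding funpow.simps comp_def assms ..
  then show ?thesis unfolding has_matching_def by (intro exI[of _ "Suc n"] conjI) simp_all
qed

context tribonacci
begin

lemma eq_frac_or_frac_minus_1:
  fixes y h :: real
  assumes "y - h \<in> \<int>" "\<bar>y\<bar> < 1" "0 < h" "h < 1"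
  shows "y = h \<or> y = h - 1"
proof -
  obtain k :: int where k: "y - h = of_int k" using assms(1) by (auto elim: Ints_cases)
  have "-2 < real_of_int k" "real_of_int k < 1" using assms k by linarith+
  then have "k = 0 \<or> k = -1" by auto
  then show ?thesis using k by auto
qed

lemma gap_step:
  assumes h: "h \<in> {0, \<gamma>} \<union> gaps" and y: "y - \<beta> * h \<in> \<int>" "\<bar>y\<bar> < 1"
  shows "\<bar>y\<bar> \<in> {0, \<gamma>} \<union> gaps"
proof -
  note b = gamma_bounds gamma_cube_bounds
  have frac: "\<bar>y\<bar> = g \<or> \<bar>y\<bar> = 1 - g" if "\<beta> * h - g \<in> \<int>" "0 < g" "g < 1" for g
  proof -
    have "y - g = (y - \<beta> * h) + (\<beta> * h - g)" by simp
    then have "y - g \<in> \<int>" using y(1) that(1) by (metis Ints_add)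
    then have "y = g \<or> y = g - 1" by (rule eq_frac_or_frac_minus_1) (use that y in auto)
    then show ?thesis using that(2,3) by auto
  qed
  have int: "\<bar>y\<bar> = 0" if "\<beta> * h \<in> \<int>"
  proof -
    have "y - \<beta> * h + \<beta> * h \<in> \<int>" using y(1) that by (rule Ints_add)
    then have "y \<in> \<int>" by simp
    then show ?thesis using y(2) by (auto elim!: Ints_cases)
  qed
  consider "h = 0" | "h = \<gamma>" | "h = 1 - \<gamma>^3" | "h = 1 - \<gamma>" | "h = \<gamma>^3" | "h = \<gamma>^2" | "h = 1 - \<gamma>^2"
    using h unfolding gaps_def by blast
  then show ?thesis
  proof cases
    case 1
    then show ?thesis using int by simp
  next
    case 2
    then show ?thesis using int beta_gamma by simp
  next
    case 3
    then have "\<bar>y\<bar> = \<gamma> \<or> \<bar>y\<bar> = 1 - \<gamma>" using frac[of \<gamma>] gap_ints(1) b by simp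
    then show ?thesis unfolding gaps_def by blast
  next
    case 4
    then have "\<bar>y\<bar> = 1 - \<gamma>^3 \<or> \<bar>y\<bar> = 1 - (1 - \<gamma>^3)" using frac[of "1 - \<gamma>^3"] gap_ints(2) b by simp
    then show ?thesis unfolding gaps_def by auto
  next
    case 5
    then have "\<bar>y\<bar> = \<gamma>^2 \<or> \<bar>y\<bar> = 1 - \<gamma>^2" using frac[of "\<gamma>^2"] gap_ints(3) b by simp
    then show ?thesis unfolding gaps_def by blast
  next
    case 6
    then have "\<bar>y\<bar> = \<gamma> \<or> \<bar>y\<bar> = 1 - \<gamma>" using frac[of \<gamma>] gap_ints(5) b by simp
    then show ?thesis unfolding gaps_def by blast
  next
    case 7
    then have "\<bar>y\<bar> = \<gamma>^2 \<or> \<bar>y\<bar> = 1 - \<gamma>^2" using frac[of "\<gamma>^2"] gap_ints(4) b by simp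
    then show ?thesis unfolding gaps_def by blast
  qed
qed

text \<open>
  The first distance is \<open>A\<close> or \<open>C\<close> because \<open>\<beta> = 2 - \<gamma>\<^sup>3\<close>.  A negative difference is handled by
  exchanging the roles of the two orbits.
\<close>

lemma orbit_gap:
  assumes "0 < n"
  shows "\<bar>(gen_beta_map \<alpha> \<beta> ^^ n) 1 - (gen_beta_map \<alpha> \<beta> ^^ n) 0\<bar> \<in> {0, \<gamma>} \<union> gaps"
  using assms
proof (induction n rule: nat_induct_non_zero)
  case 1
  have "gen_beta_map \<alpha> \<beta> 1 - gen_beta_map \<alpha> \<beta> 0 - (1 - \<gamma>^3) \<in> \<int>"
  proof -
    have "\<beta> = 2 - \<gamma>^3" using beta_eq gamma_cubic by simp
    then have "gen_beta_map \<alpha> \<beta> 1 - gen_beta_map \<alpha> \<beta> 0 - (1 - \<gamma>^3) = of_int (1 - \<lfloor>\<beta> * 1 + \<alpha>\<rfloor> + \<lfloor>\<beta> * 0 + \<alpha>\<rfloor>)"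
      by (simp add: gen_beta_map_def frac_def)
    then show ?thesis by (metis Ints_of_int)
  qed
  moreover have "\<bar>gen_beta_map \<alpha> \<beta> 1 - gen_beta_map \<alpha> \<beta> 0\<bar> < 1"
    unfolding gen_beta_map_def
    using frac_ge_0[of "\<beta> * 1 + \<alpha>"] frac_lt_1[of "\<beta> * 1 + \<alpha>"] frac_ge_0[of "\<beta> * 0 + \<alpha>"] frac_lt_1[of "\<beta> * 0 + \<alpha>"]
    by linarith
  ultimately have "gen_beta_map \<alpha> \<beta> 1 - gen_beta_map \<alpha> \<beta> 0 = 1 - \<gamma>^3 \<or> gen_beta_map \<alpha> \<beta> 1 - gen_beta_map \<alpha> \<beta> 0 = 1 - \<gamma>^3 - 1"
    using gamma_pos gamma_cube_bounds by (intro eq_frac_or_frac_minus_1) auto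
  then show ?case using gamma_cube_bounds unfolding gaps_def by auto
next
  case (Suc n)
  let ?T = "gen_beta_map \<alpha> \<beta>"
  define u where "u = (?T ^^ n) 1"
  define v where "v = (?T ^^ n) 0"
  define y where "y = ?T u - ?T v"
  have "y = \<beta> * (u - v) - of_int (\<lfloor>\<beta> * u + \<alpha>\<rfloor> - \<lfloor>\<beta> * v + \<alpha>\<rfloor>)"
    by (simp add: y_def gen_beta_map_def frac_def algebra_simps)
  then have i: "y - \<beta> * (u - v) \<in> \<int>" by simp
  have y1: "\<bar>y\<bar> < 1"
    unfolding y_def gen_beta_map_def
    using frac_ge_0[of "\<beta> * u + \<alpha>"] frac_lt_1[of "\<beta> * u + \<alpha>"] frac_ge_0[of "\<beta> * v + \<alpha>"] frac_lt_1[of "\<beta> * v + \<alpha>"]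
    by linarith
  have IH: "\<bar>u - v\<bar> \<in> {0, \<gamma>} \<union> gaps" using Suc by (simp add: u_def v_def)
  have "\<bar>y\<bar> \<in> {0, \<gamma>} \<union> gaps"
  proof (cases "0 \<le> u - v")
    case True
    then show ?thesis using gap_step[OF IH, of y] i y1 by simp
  next
    case False
    have "- y - \<beta> * \<bar>u - v\<bar> = - (y - \<beta> * (u - v))" using False by (simp add: algebra_simps)
    then have "- y - \<beta> * \<bar>u - v\<bar> \<in> \<int>" using i by (metis minus_in_Ints_iff)
    then show ?thesis using gap_step[OF IH, of "- y"] y1 by simp
  qed
  then show ?case by (simp add: y_def u_def v_def)
qed

text \<open>
  Density of matching pairs gives one robust pair in each cell of a grid of mesh \<open>\<eta>\<close>.  There are finitely many
  cells and gaps, so one \<open>\<epsilon>\<close> serves all of them.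
\<close>

lemma robust_points:
  assumes a: "0 \<le> \<alpha>0" "\<alpha>0 \<le> 1" "\<alpha>0 < \<gamma> \<or> 1 - \<gamma> + \<gamma>^3 < \<alpha>0" and eta: "0 < \<eta>"
  shows "\<exists>\<epsilon>>0. \<forall>g\<in>gaps. \<forall>w. 0 \<le> w \<longrightarrow> w + \<eta> \<le> 1 - g \<longrightarrow>
    (\<exists>z. \<bar>z - w\<bar> + \<epsilon> \<le> \<eta> \<and> (\<forall>\<alpha> x. \<bar>\<alpha> - \<alpha>0\<bar> < \<epsilon> \<longrightarrow> \<bar>x - z\<bar> < \<epsilon> \<longrightarrow>
      (\<exists>k. (gen_beta_map \<alpha> \<beta> ^^ k) x = (gen_beta_map \<alpha> \<beta> ^^ k) (x + g))))"
proof -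
  define Q where "Q g z \<epsilon> \<longleftrightarrow> (\<forall>\<alpha> x. \<bar>\<alpha> - \<alpha>0\<bar> < \<epsilon> \<longrightarrow> \<bar>x - z\<bar> < \<epsilon> \<longrightarrow>
      (\<exists>k. (gen_beta_map \<alpha> \<beta> ^^ k) x = (gen_beta_map \<alpha> \<beta> ^^ k) (x + g)))" for g z \<epsilon>
  define P where "P g j \<epsilon> \<longleftrightarrow> (real j * \<eta> + \<eta> \<le> 1 - g \<longrightarrow>
      (\<exists>z. real j * \<eta> \<le> z - \<epsilon> \<and> z + \<epsilon> \<le> real j * \<eta> + \<eta> \<and> Q g z \<epsilon>))" for g j \<epsilon>
  have "\<forall>\<^sub>F \<epsilon> in at_right 0. P g j \<epsilon>" if g: "g \<in> gaps" for g j
  proof (cases "real j * \<eta> + \<eta> \<le> 1 - g")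
    case True
    have "\<not> surviving \<alpha>0 g (real j * \<eta>) (real j * \<eta> + \<eta>)"
      using not_surviving[OF a g] .
    then obtain z where z: "real j * \<eta> < z" "z < real j * \<eta> + \<eta>" "robustly_match \<alpha>0 \<beta> z (z + g)"
      using True eta by (auto simp: surviving_def)
    obtain \<epsilon>0 where e0: "\<epsilon>0 > 0" "Q g z \<epsilon>0"
      using robustly_match_open[OF z(3)] unfolding Q_def by blast
    define b where "b = min \<epsilon>0 (min (z - real j * \<eta>) (real j * \<eta> + \<eta> - z))"
    have "P g j \<epsilon>" if "0 < \<epsilon>" "\<epsilon> < b" for \<epsilon>
    proof -
      have "\<epsilon> < \<epsilon>0" using that by (simp add: b_def)
      then have "Q g z \<epsilon>" using e0(2) unfolding Q_def by (meson less_trans)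
      then show ?thesis unfolding P_def using that by (intro impI exI[of _ z]) (auto simp: b_def)
    qed
    moreover have "0 < b" using e0 z by (simp add: b_def)
    ultimately show ?thesis unfolding eventually_at_right_field by blast
  qed (simp add: P_def)
  then have "\<forall>\<^sub>F \<epsilon> in at_right 0. \<forall>g\<in>gaps. \<forall>j\<in>{..nat \<lceil>1 / \<eta>\<rceil>}. P g j \<epsilon>"
    by (intro eventually_ball_finite ballI) (auto simp: gaps_def)
  then obtain b where b: "b > 0" "\<And>\<epsilon>. 0 < \<epsilon> \<Longrightarrow> \<epsilon> < b \<Longrightarrow> \<forall>g\<in>gaps. \<forall>j\<in>{..nat \<lceil>1 / \<eta>\<rceil>}. P g j \<epsilon>"
    unfolding eventually_at_right_field by blast
  define \<epsilon> where "\<epsilon> = b / 2"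
  have e: "0 < \<epsilon>" "\<And>g j. g \<in> gaps \<Longrightarrow> j \<le> nat \<lceil>1 / \<eta>\<rceil> \<Longrightarrow> P g j \<epsilon>"
    using b(1) b(2)[of "b / 2"] by (auto simp: \<epsilon>_def)
  show ?thesis
  proof (rule exI[of _ \<epsilon>], intro conjI ballI allI impI)
    fix g w assume g: "g \<in> gaps" and w: "0 \<le> w" "w + \<eta> \<le> 1 - g"
    define j where "j = nat \<lfloor>w / \<eta>\<rfloor>"
    have wj: "real j \<le> w / \<eta>" "w / \<eta> < real j + 1"
      unfolding j_def using w eta by (simp_all add: of_nat_nat)
    then have wj': "real j * \<eta> \<le> w" "w < real j * \<eta> + \<eta>"
      using eta by (simp_all add: field_simps)
    have "0 < g" using g gamma_bounds gamma_cube_bounds by (auto simp: gaps_def)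
    then have "w \<le> 1" using w eta by linarith
    then have "w / \<eta> \<le> 1 / \<eta>" using eta by (intro divide_right_mono) auto
    then have "j \<le> nat \<lceil>1 / \<eta>\<rceil>" using wj(1) by linarith
    then have "P g j \<epsilon>" using e(2) g by blast
    then obtain z where z: "real j * \<eta> \<le> z - \<epsilon>" "z + \<epsilon> \<le> real j * \<eta> + \<eta>" "Q g z \<epsilon>"
      unfolding P_def using w wj' by auto
    show "\<exists>z. \<bar>z - w\<bar> + \<epsilon> \<le> \<eta> \<and> (\<forall>\<alpha> x. \<bar>\<alpha> - \<alpha>0\<bar> < \<epsilon> \<longrightarrow> \<bar>x - z\<bar> < \<epsilon> \<longrightarrow>
      (\<exists>k. (gen_beta_map \<alpha> \<beta> ^^ k) x = (gen_beta_map \<alpha> \<beta> ^^ k) (x + g)))"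
    proof (rule exI[of _ z], rule conjI)
      show "\<bar>z - w\<bar> + \<epsilon> \<le> \<eta>" using z(1,2) wj' by linarith
    qed (use z(3) in \<open>unfold Q_def\<close>)
  qed (rule e)
qed

lemma orbit_affine:
  assumes "x \<in> {0, 1}" "0 < r" "ball \<alpha>0 r \<subseteq> {0..1}" "ball \<alpha>0 r \<inter> discontinuities n = {}" "\<alpha> \<in> ball \<alpha>0 r"
  shows "(gen_beta_map \<alpha> \<beta> ^^ n) x = (gen_beta_map \<alpha>0 \<beta> ^^ n) x + slope \<beta> n * (\<alpha> - \<alpha>0)"
proof -
  have "lift \<beta> x \<alpha> n = lift \<beta> x \<alpha>0 n"
    by (rule lift_constant[OF assms(1) is_interval_ball_real assms(3,4,5)]) (use assms(2) in auto)
  then show ?thesis by (simp add: lift_def algebra_simps)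
qed

lemma nonmatching_gap:
  assumes "0 < n" and nm: "\<not> has_matching \<alpha> \<beta>"
  shows "\<bar>(gen_beta_map \<alpha> \<beta> ^^ n) 1 - (gen_beta_map \<alpha> \<beta> ^^ n) 0\<bar> \<in> gaps"
proof -
  let ?T = "gen_beta_map \<alpha> \<beta>"
  define u where "u = (?T ^^ n) 1"
  define v where "v = (?T ^^ n) 0"
  have T: "?T (x + \<gamma>) = ?T x" for x
  proof -
    have "\<beta> * (x + \<gamma>) + \<alpha> = (\<beta> * x + \<alpha>) + 1" using beta_gamma by (simp add: algebra_simps)
    then show ?thesis unfolding gen_beta_map_def by (simp only: frac_1_eq)
  qed
  have "u \<noteq> v" using has_matchingI[of n \<alpha> \<beta>] nm by (auto simp: u_def v_def)
  moreover have "\<bar>u - v\<bar> \<noteq> \<gamma>"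
  proof
    assume "\<bar>u - v\<bar> = \<gamma>"
    then have "u = v + \<gamma> \<or> v = u + \<gamma>" by linarith
    then have "?T u = ?T v" using T by metis
    then show False using has_matchingI[of "Suc n" \<alpha> \<beta>] nm by (simp add: u_def v_def)
  qed
  ultimately show ?thesis using orbit_gap[OF \<open>0 < n\<close>, of \<alpha>] unfolding u_def v_def by auto
qed

text \<open>
  At a scale \<open>r = \<eta> / s\<^sub>n\<close> without discontinuities, the pair of \<open>n\<close>-th iterates moves rigidly, with speed \<open>s\<^sub>n\<close>, through
  an interval of pairs of length \<open>2 * \<eta>\<close>.  The robust pair in this interval pulls back to an
  interval of parameters of relative size \<open>\<epsilon> / \<eta>\<close>.
\<close>

lemma nonmatching_porous:
  assumes a: "0 < \<alpha>0" "\<alpha>0 < 1" "\<alpha>0 \<noteq> \<gamma>" "\<alpha>0 \<noteq> 1 - \<gamma> + \<gamma>^3"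
    and nm: "\<not> has_matching \<alpha>0 \<beta>"
    and eta: "0 < \<eta>" and uncrowded: "\<forall>N. \<exists>n\<ge>N. \<alpha>0 \<notin> crowded \<eta> n"
  shows "\<exists>c>0. \<forall>\<delta>>0. \<exists>r p. 0 < r \<and> r < \<delta> \<and> ball p (c * r) \<subseteq> ball \<alpha>0 r \<and>
           (\<forall>\<alpha>\<in>ball p (c * r). has_matching \<alpha> \<beta>)"
proof -
  have "\<alpha>0 < \<gamma> \<or> 1 - \<gamma> + \<gamma>^3 < \<alpha>0"
    using matching_middle[of \<alpha>0] a nm by argo
  from robust_points[OF _ _ this eta]
  obtain \<epsilon> where e: "0 < \<epsilon>" and robust: "\<And>g w. \<lbrakk>g \<in> gaps; 0 \<le> w; w + \<eta> \<le> 1 - g\<rbrakk> \<Longrightarrow>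
    \<exists>z. \<bar>z - w\<bar> + \<epsilon> \<le> \<eta> \<and> (\<forall>\<alpha> x. \<bar>\<alpha> - \<alpha>0\<bar> < \<epsilon> \<longrightarrow> \<bar>x - z\<bar> < \<epsilon> \<longrightarrow>
      (\<exists>k. (gen_beta_map \<alpha> \<beta> ^^ k) x = (gen_beta_map \<alpha> \<beta> ^^ k) (x + g)))"
    using a by (metis less_imp_le)
  show ?thesis
  proof (rule exI[of _ "\<epsilon> / \<eta>"], intro conjI allI impI)
    show "0 < \<epsilon> / \<eta>" using e eta by simp
    fix \<delta> :: real assume d: "0 < \<delta>"
    define m where "m = min (min \<delta> \<epsilon>) (min \<alpha>0 (1 - \<alpha>0))"
    have m: "0 < m" "m \<le> \<delta>" "m \<le> \<epsilon>" "m \<le> \<alpha>0" "m \<le> 1 - \<alpha>0"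
      using d e a by (simp_all add: m_def)
    obtain N :: nat where N: "\<eta> / m < real N" using reals_Archimedean2 by blast
    obtain n where n: "n \<ge> Suc N" "\<alpha>0 \<notin> crowded \<eta> n" using uncrowded by blast
    define s where "s = slope \<beta> n"
    have s: "real n \<le> s" "0 < s" using slope_ge slope_pos n by (auto simp: s_def)
    define r where "r = \<eta> / s"
    have r0: "0 < r" using eta s by (simp add: r_def)
    have "\<eta> / m < s" using N n s by linarith
    then have rm: "r < m" using m s by (simp add: r_def field_simps)
    have sr: "s * r = \<eta>" using s by (simp add: r_def)
    have I: "ball \<alpha>0 r \<subseteq> {0..1}" using rm m by (auto simp: dist_real_def)
    have disc: "ball \<alpha>0 r \<inter> discontinuities n = {}"
      using n(2) by (auto simp: crowded_def r_def s_def dist_real_def abs_less_iff)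
    define g where "g = \<bar>(gen_beta_map \<alpha>0 \<beta> ^^ n) 1 - (gen_beta_map \<alpha>0 \<beta> ^^ n) 0\<bar>"
    have g: "g \<in> gaps" unfolding g_def by (rule nonmatching_gap) (use a nm n in auto)
    obtain x y :: real where xy: "{x, y} = {0, 1}" "(gen_beta_map \<alpha>0 \<beta> ^^ n) y = (gen_beta_map \<alpha>0 \<beta> ^^ n) x + g"
    proof (cases "(gen_beta_map \<alpha>0 \<beta> ^^ n) 0 \<le> (gen_beta_map \<alpha>0 \<beta> ^^ n) 1")
      case True
      then show ?thesis using that[of 0 1] by (simp add: g_def)
    next
      case False
      then show ?thesis using that[of 1 0] by (simp add: g_def insert_commute)
    qed
    then have x01: "x \<in> {0, 1}" and y01: "y \<in> {0, 1}" by auto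
    define w where "w = (gen_beta_map \<alpha>0 \<beta> ^^ n) x"
    have X: "(gen_beta_map \<alpha> \<beta> ^^ n) x = w + s * (\<alpha> - \<alpha>0)"
      and Y: "(gen_beta_map \<alpha> \<beta> ^^ n) y = w + s * (\<alpha> - \<alpha>0) + g" if "\<alpha> \<in> ball \<alpha>0 r" for \<alpha>
      using orbit_affine[OF x01 r0 I disc that] orbit_affine[OF y01 r0 I disc that] xy(2)
      by (simp_all add: w_def s_def)
    have w0: "0 \<le> w" using orbit_range[of x n \<alpha>0 \<beta>] x01 by (auto simp: w_def)
    have wg: "w + g \<le> 1" using orbit_range[of y n \<alpha>0 \<beta>] y01 xy(2) by (auto simp: w_def)
    have w1: "w + \<eta> \<le> 1 - g"
    proof (rule ccontr)
      assume "\<not> w + \<eta> \<le> 1 - g"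
      \<comment> \<open>Otherwise the upper point would leave \<open>{0..1}\<close> for some parameter in the ball.\<close>
    define t where "t = (1 - g - w + \<eta>) / 2"
      have t: "1 - g - w < t" "t < \<eta>" "0 \<le> t"
        using \<open>\<not> w + \<eta> \<le> 1 - g\<close> wg eta by (auto simp: t_def)
      have "t / s < r" using t(2) s by (simp add: r_def divide_strict_right_mono)
      then have "\<alpha>0 + t / s \<in> ball \<alpha>0 r" using t(3) s by (simp add: dist_real_def)
      from Y[OF this] have "(gen_beta_map (\<alpha>0 + t / s) \<beta> ^^ n) y = w + t + g" using s by simp
      then show False using orbit_range[of y n "\<alpha>0 + t / s" \<beta>] y01 t(1) by auto
    qed
    obtain z where z: "\<bar>z - w\<bar> + \<epsilon> \<le> \<eta>" and match: "\<And>\<alpha> x. \<lbrakk>\<bar>\<alpha> - \<alpha>0\<bar> < \<epsilon>; \<bar>x - z\<bar> < \<epsilon>\<rbrakk> \<Longrightarrow>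
      \<exists>k. (gen_beta_map \<alpha> \<beta> ^^ k) x = (gen_beta_map \<alpha> \<beta> ^^ k) (x + g)"
      using robust[OF g w0 w1] by blast
    define p where "p = \<alpha>0 + (z - w) / s"
    have cr: "\<epsilon> / \<eta> * r = \<epsilon> / s" using eta by (simp add: r_def)
    have near: "\<bar>w + s * (\<alpha> - \<alpha>0) - z\<bar> < \<epsilon>" if "\<alpha> \<in> ball p (\<epsilon> / \<eta> * r)" for \<alpha>
    proof -
      have "\<bar>\<alpha> - p\<bar> < \<epsilon> / s" using that unfolding cr by (simp add: dist_real_def abs_minus_commute)
      then have "s * \<bar>\<alpha> - p\<bar> < \<epsilon>" using s by (simp add: field_simps)
      moreover have "w + s * (\<alpha> - \<alpha>0) - z = s * (\<alpha> - p)" using s by (simp add: p_def field_simps)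
      ultimately show ?thesis using s by (simp add: abs_mult)
    qed
    have sub: "\<alpha> \<in> ball \<alpha>0 r" if "\<alpha> \<in> ball p (\<epsilon> / \<eta> * r)" for \<alpha>
    proof -
      have "\<bar>s * (\<alpha> - \<alpha>0)\<bar> < s * r" using near[OF that] z unfolding sr by linarith
      then have "\<bar>\<alpha> - \<alpha>0\<bar> < r" using s by (simp add: abs_mult)
      then show ?thesis by (simp add: dist_real_def abs_minus_commute)
    qed
    show "\<exists>r p. 0 < r \<and> r < \<delta> \<and> ball p (\<epsilon> / \<eta> * r) \<subseteq> ball \<alpha>0 r \<and>
           (\<forall>\<alpha>\<in>ball p (\<epsilon> / \<eta> * r). has_matching \<alpha> \<beta>)"
    proof (rule exI[of _ r], rule exI[of _ p], intro conjI ballI)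
      show "0 < r" by (rule r0)
      show "r < \<delta>" using rm m by simp
      show "ball p (\<epsilon> / \<eta> * r) \<subseteq> ball \<alpha>0 r" using sub by blast
      fix \<alpha> assume \<alpha>: "\<alpha> \<in> ball p (\<epsilon> / \<eta> * r)"
      let ?T = "gen_beta_map \<alpha> \<beta>"
      have "\<bar>\<alpha> - \<alpha>0\<bar> < \<epsilon>" using sub[OF \<alpha>] rm m by (simp add: dist_real_def abs_minus_commute)
      from match[OF this near[OF \<alpha>]]
      obtain k where "(?T ^^ k) ((?T ^^ n) x) = (?T ^^ k) ((?T ^^ n) y)"
        unfolding X[OF sub[OF \<alpha>]] Y[OF sub[OF \<alpha>]] by blast
      then have "(?T ^^ (k + n)) x = (?T ^^ (k + n)) y" by (simp add: funpow_add)
      then have "(?T ^^ (k + n)) 0 = (?T ^^ (k + n)) 1" using xy(1) by (auto simp: doubleton_eq_iff)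
      then show "has_matching \<alpha> \<beta>" by (rule has_matchingI)
    qed
  qed
qed

lemma negligible_nonmatching: "negligible {\<alpha> \<in> {0..1}. \<not> has_matching \<alpha> \<beta>}"
proof -
  define B where "B = {\<alpha>. \<forall>\<eta>>0. \<exists>N. \<forall>n\<ge>N. \<alpha> \<in> crowded \<eta> n}"
  define S where "S = {\<alpha> \<in> {0..1}. \<not> has_matching \<alpha> \<beta>} - B - {0, 1, \<gamma>, 1 - \<gamma> + \<gamma>^3}"
  have "negligible S"
  proof (rule negligible_porous)
    fix \<alpha>0 assume "\<alpha>0 \<in> S"
    then have a: "0 < \<alpha>0" "\<alpha>0 < 1" "\<alpha>0 \<noteq> \<gamma>" "\<alpha>0 \<noteq> 1 - \<gamma> + \<gamma>^3" "\<not> has_matching \<alpha>0 \<beta>" and "\<alpha>0 \<notin> B"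
      by (auto simp: S_def)
    then obtain \<eta> where "0 < \<eta>" "\<forall>N. \<exists>n\<ge>N. \<alpha>0 \<notin> crowded \<eta> n" by (auto simp: B_def)
    from nonmatching_porous[OF a this]
    obtain c where c: "c > 0" and hole: "\<And>\<delta>. \<delta> > 0 \<Longrightarrow> \<exists>r p. 0 < r \<and> r < \<delta> \<and> ball p (c * r) \<subseteq> ball \<alpha>0 r \<and>
           (\<forall>\<alpha>\<in>ball p (c * r). has_matching \<alpha> \<beta>)"
      by auto
    have disjoint: "I \<inter> S = {}" if "\<forall>\<alpha>\<in>I. has_matching \<alpha> \<beta>" for I
      using that by (auto simp: S_def)
    show "\<exists>c>0. \<forall>\<delta>>0. \<exists>r p. 0 < r \<and> r < \<delta> \<and> ball p (c * r) \<subseteq> ball \<alpha>0 r \<and> ball p (c * r) \<inter> S = {}"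
      using c hole disjoint by meson
  qed
  moreover have "negligible B" unfolding B_def by (rule almost_all_uncrowded)
  moreover have "negligible {0, 1, \<gamma>, 1 - \<gamma> + \<gamma>^3}" by (intro negligible_finite) simp
  ultimately have "negligible (S \<union> B \<union> {0, 1, \<gamma>, 1 - \<gamma> + \<gamma>^3})" by (intro negligible_Un)
  then show ?thesis by (rule negligible_subset) (auto simp: S_def)
qed

end

theorem proposition3p2:
  fixes \<beta> :: real
  assumes "\<beta> > 1" and "\<beta> ^ 3 = \<beta> ^ 2 + \<beta> + 1"
  shows "AE \<alpha>\<in>{0..1} in lebesgue. has_matching \<alpha> \<beta>"
proof -
  interpret tribonacci \<beta> "1 / \<beta>" by unfold_locales (use assms in auto)
  have "{\<alpha> \<in> {0..1}. \<not> has_matching \<alpha> \<beta>} \<in> null_sets lebesgue"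
    using negligible_nonmatching by (simp add: negligible_iff_null_sets)
  then show ?thesis by (rule AE_I') auto
qed

end
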